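(* The following hold. (i) Let $n\in\{2,3\}$ and let $a_1,\ldots,a_n\in\mathbb{C}^n$ be vectors such that $\|a_i\|_\infty\le 1$ for every $i=1,\ldots,n$. Then there exists a unimodular vector $x\in\mathbb{C}^n$ (that is, every coordinate of $x$ has modulus $1$) such that $|\langle x,a_i\rangle|\le\sqrt{n}$ for every $i=1,\ldots,n$. (ii) In particular, for $n\in\{2,3\}$ we have $d_{BM}(\ell_1^n(\mathbb{C}),\ell_\infty^n(\mathbb{C}))=\sqrt{n}$. (iii) For all $1\le q\le 2\le p\le\infty$ we have $$d_{BM}(\ell_p^2(\mathbb{C}),\ell_q^2(\mathbb{C}))=2^{\alpha},\qquad \alpha=\max\left\{\frac12-\frac1p,\ \frac1q-\frac12\right\}.$$
   Context: For $1\le p<\infty$, $\ell_p^n(\mathbb{C})$ is the space $\mathbb{C}^n$ with the norm $\|x\|_p=(|x_1|^p+\cdots+|x_n|^p)^{1/p}$, and $\ell_\infty^n(\mathbb{C})$ is $\mathbb{C}^n$ with the maximum norm $\|x\|_\infty=\max_i|x_i|$; the convention $1/\infty=0$ is used. The inner product on $\mathbb{C}^n$ is $\langle x,y\rangle=x_1\overline{y_1}+\cdots+x_n\overline{y_n}$. For two normed spaces $X,Y$ over $\mathbb{C}$ of the same finite dimension, the Banach--Mazur distance is $d_{BM}(X,Y)=\inf\|A\|_{X\to Y}\cdot\|A^{-1}\|_{Y\to X}$, where the infimum is over all invertible ($\mathbb{C}$-)linear operators $A:X\to Y$ and $\|\cdot\|_{X\to Y}$ denotes the operator norm. *)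

theory Defs
  imports "HOL-Analysis.Analysis"
begin

(* The exponent ranges over the extended reals, only 1 \<le> p \<le> \<infinity> being meaningful. *)
definition lp_norm :: "ereal \<Rightarrow> complex ^ 'n \<Rightarrow> real" where
  "lp_norm p x =
     (if p = \<infinity> then Max (range (\<lambda>i. cmod (x $ i)))
      else (\<Sum>i\<in>UNIV. cmod (x $ i) powr real_of_ereal p) powr (1 / real_of_ereal p))"

(* The library's inner product on complex ^ 'n is the real one, i.e. the real part of this. *)
definition cinner :: "complex ^ 'n \<Rightarrow> complex ^ 'n \<Rightarrow> complex" where
  "cinner x y = (\<Sum>i\<in>UNIV. x $ i * cnj (y $ i))"

definition unimodular :: "complex ^ 'n \<Rightarrow> bool" where
  "unimodular x \<longleftrightarrow> (\<forall>i. cmod (x $ i) = 1)"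

(* Norms are passed as functions, since the spaces compared here differ only in the norm
   and hence cannot be told apart by the type-class norm (and onorm) on complex ^ 'n.
   For linear A and norms N, M the set is nonempty and bounded above. *)
definition op_norm ::
  "(complex ^ 'n \<Rightarrow> real) \<Rightarrow> (complex ^ 'm \<Rightarrow> real) \<Rightarrow> (complex ^ 'n \<Rightarrow> complex ^ 'm) \<Rightarrow> real"
  where "op_norm N M A = Sup {M (A x) | x. N x \<le> 1}"

(* Linearity is over the complex field: the class-based constant linear is only real-linear. *)
definition banach_mazur ::
  "(complex ^ 'n \<Rightarrow> real) \<Rightarrow> (complex ^ 'm \<Rightarrow> real) \<Rightarrow> real"
  where "banach_mazur N M =
    Inf {op_norm N M A * op_norm M N (inv A) | A. Vector_Spaces.linear (*s) (*s) A \<and> bij A}"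

end

(*
  For n = 3 let \<omega> be a primitive cube root of unity.  For a base point x consider the nine vectors
  (x_1, \<omega>^j x_2, \<omega>^k x_3), and for a row a the set of indices (j, k) at which the product with a has
  modulus larger than sqrt 3.  Viewed as a subset of the affine plane Z_3^2 this set is very sparse:
  it contains no full line of direction (1, 2), it does not meet two lines of that direction in two
  points each, and a full line of any other direction is the whole set.  Hence two such sets never
  cover eight of the nine points.  On the other hand the base point can be chosen so that the set of
  the first row has at most one element, so one of the remaining eight points is good for all three
  rows.

  The lower bound in (ii) applies (i) to the rows of A / norm A, the upper bound is attained by the
  Fourier matrix.  For (iii) the lower bounds come from type 2 and cotype 2 estimates with a single
  unimodular coefficient, and the upper bound from the 2 x 2 Hadamard matrix and Clarkson's
  inequality.
*)
theory Submission
  imports Defs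
begin

text \<open>The constant sqrt 3 reappears as \<open>cmod (1 - omega)\<close>: changing one of the
  two exponents moves the product with a row by at most sqrt 3. Products that all exceed sqrt 3 are
  thus points outside a disc with short mutual differences, and each sparsity condition becomes a
  problem of plane geometry. Counting alone does not prove (i). The sparsity conditions allow four
  points per row, and even after the base point has reduced one row to a single point, 1 + 4 + 4 = 9
  leaves nothing over. This is why full lines have to be excluded as well. In dimension 2 one
  unimodular scalar can prescribe the signs of two cross terms, one per coordinate, whereas a real
  sign can prescribe only one. This replaces averaging over signs in the lower bounds of (iii) and
  also settles n = 2 in (i).\<close>

section \<open>Products of a row with nine unimodular vectors\<close>

text \<open>
  Write a = m (x - iy) and b = m (x' - iy'). The hypotheses give sqrt 3 * y > 1 + |x|,
  (1 - |x|)^2 + y^2 > (x + x')^2 + (y + y')^2 and likewise with a and b exchanged, which is impossible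
  for the smaller one of y and y'.
\<close>

lemma no_parallelogram:
  fixes m1 m2 a1 a2 b1 b2 :: real
  defines "r \<equiv> sqrt 3"
  assumes ab: "(a1 + b1)\<^sup>2 + (a2 + b2)\<^sup>2 \<le> 3"
    and ia: "(r * m1 + a2)\<^sup>2 + (r * m2 - a1)\<^sup>2 \<le> 3"
    and ib: "(r * m1 + b2)\<^sup>2 + (r * m2 - b1)\<^sup>2 \<le> 3"
    and pa: "(m1 + a1)\<^sup>2 + (m2 + a2)\<^sup>2 > 3" and ma: "(m1 - a1)\<^sup>2 + (m2 - a2)\<^sup>2 > 3"
    and pb: "(m1 + b1)\<^sup>2 + (m2 + b2)\<^sup>2 > 3" and mb: "(m1 - b1)\<^sup>2 + (m2 - b2)\<^sup>2 > 3"
  shows False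
proof -
  have r2: "r * r = 3" and r0: "r > 0" by (auto simp: r_def)
  define M where "M = m1\<^sup>2 + m2\<^sup>2"
  have M0: "M \<ge> 0" by (simp add: M_def)
  have key: "(M - \<bar>p\<bar>)\<^sup>2 + t\<^sup>2 > 3 * M \<and> r * t > M + \<bar>p\<bar>"
    if p: "p = m1 * c1 + m2 * c2" and t: "t = m2 * c1 - m1 * c2"
      and ic: "(r * m1 + c2)\<^sup>2 + (r * m2 - c1)\<^sup>2 \<le> 3"
      and pc: "(m1 + c1)\<^sup>2 + (m2 + c2)\<^sup>2 > 3" and mc: "(m1 - c1)\<^sup>2 + (m2 - c2)\<^sup>2 > 3"
    for c1 c2 p t :: real
  proof -
    define q where "q = c1\<^sup>2 + c2\<^sup>2"
    have "(m1 + c1)\<^sup>2 + (m2 + c2)\<^sup>2 = M + q + 2 * p" "(m1 - c1)\<^sup>2 + (m2 - c2)\<^sup>2 = M + q - 2 * p"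
      by (simp_all add: M_def q_def p power2_eq_square algebra_simps)
    then have 1: "M + q - 2 * \<bar>p\<bar> > 3" using pc mc by linarith
    have "(r * m1 + c2)\<^sup>2 + (r * m2 - c1)\<^sup>2 = (r * r) * M + q - 2 * (r * t)"
      by (simp add: M_def q_def t power2_eq_square algebra_simps)
    then have 2: "3 * M + q - 2 * (r * t) \<le> 3" using ic r2 by simp
    have 3: "r * t > M + \<bar>p\<bar>" using 1 2 by linarith
    have "M \<noteq> 0"
    proof
      assume "M = 0"
      then have "m1 = 0" "m2 = 0" by (auto simp: M_def sum_power2_eq_zero_iff)
      then show False using 3 by (simp add: p t M_def)
    qed
    then have "M > 0" using M0 by simp
    moreover have "M * q = p\<^sup>2 + t\<^sup>2" by (simp add: M_def q_def p t power2_eq_square algebra_simps)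
    then have "M * (M + q - 2 * \<bar>p\<bar>) = (M - \<bar>p\<bar>)\<^sup>2 + t\<^sup>2"
      by (simp add: power2_diff algebra_simps power2_eq_square flip: abs_mult)
    ultimately show ?thesis using 1 3 mult_strict_left_mono[of 3 "M + q - 2 * \<bar>p\<bar>" M]
      by (simp add: mult.commute)
  qed
  define p where "p = m1 * a1 + m2 * a2"
  define t where "t = m2 * a1 - m1 * a2"
  define p' where "p' = m1 * b1 + m2 * b2"
  define t' where "t' = m2 * b1 - m1 * b2"
  note A = key[OF p_def t_def ia pa ma] and B = key[OF p'_def t'_def ib pb mb]
  have "(p + p')\<^sup>2 + (t + t')\<^sup>2 = M * ((a1 + b1)\<^sup>2 + (a2 + b2)\<^sup>2)"
    by (simp add: M_def p_def p'_def t_def t'_def power2_eq_square algebra_simps)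
  also have "\<dots> \<le> M * 3" using ab M0 by (intro mult_left_mono) auto
  finally have C: "(p + p')\<^sup>2 + (t + t')\<^sup>2 \<le> 3 * M" by simp
  \<comment> \<open>For the smaller \<open>t\<close> the inequalities chain up: 4 t^2 <= (t + t')^2
    <= 3 M < (M - |p|)^2 + t^2, hence 3 t^2 < (M - |p|)^2 <= (M + |p|)^2 < (r t)^2 = 3 t^2.\<close>
  have D: False if A: "(M - \<bar>p\<bar>)\<^sup>2 + t\<^sup>2 > 3 * M" "r * t > M + \<bar>p\<bar>" and C: "(t + t')\<^sup>2 \<le> 3 * M" and le: "t \<le> t'"
    for p t t' :: real
  proof -
    have "r * t > 0" using A(2) M0 by linarith
    then have t0: "t > 0" using r0 by (simp add: zero_less_mult_iff)
    have "(2 * t)\<^sup>2 \<le> (t + t')\<^sup>2" using t0 le by (intro power_mono) auto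
    then have "3 * t\<^sup>2 < (M - \<bar>p\<bar>)\<^sup>2" using A C by (simp add: power_mult_distrib)
    moreover have "(M + \<bar>p\<bar>)\<^sup>2 < (r * t)\<^sup>2" using A(2) M0 by (intro power_strict_mono) auto
    moreover have "(r * t)\<^sup>2 = 3 * t\<^sup>2" using r2 by (simp add: power2_eq_square algebra_simps)
    moreover have "(M - \<bar>p\<bar>)\<^sup>2 \<le> (M + \<bar>p\<bar>)\<^sup>2"
      using mult_nonneg_nonneg[OF M0 abs_ge_zero[of p]] by (simp add: power2_sum power2_diff)
    ultimately show False by linarith
  qed
  have "(t + t')\<^sup>2 \<le> 3 * M" using C zero_le_power2[of "p + p'"] by linarith
  moreover from this have "(t' + t)\<^sup>2 \<le> 3 * M" by (simp add: add.commute)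
  ultimately show False using D[of p t t'] D[of p' t' t] A B by (cases "t \<le> t'") auto
qed

text \<open>
  The next lemma is \<open>no_far_vertex\<close> below in coordinates relative to the symmetry axis of the edge
  from 1 to \<open>e\<^sup>2\<close>: there \<open>\<kappa> = e (1/2 - a + iy)\<close> and \<open>\<eta> = e (1/2 + d + iY)\<close>. Both cases end with an explicit
  factorization, because there is a one-parameter family of configurations with equality everywhere.
\<close>

lemma no_far_vertex_aux:
  fixes a y d Y R :: real
  defines "c \<equiv> sqrt 3 / 2"
  assumes y0: "y \<ge> 0"
    and k2: "a\<^sup>2 + (c - y)\<^sup>2 > R" and k3: "(3/2 - a)\<^sup>2 + y\<^sup>2 > R"
    and k: "3 * ((1/2 - a)\<^sup>2 + y\<^sup>2) \<le> R"
    and e: "d\<^sup>2 + (\<bar>Y\<bar> + c)\<^sup>2 \<le> R"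
    and far: "(d + a)\<^sup>2 + (Y - y)\<^sup>2 > R"
  shows False
proof -
  have c2: "c * c = 3/4" and c0: "c > 0" by (auto simp: c_def)
  define x where "x = 1/2 - a"
  have a: "a = 1/2 - x" by (simp add: x_def)
  \<comment> \<open>The points within sqrt R of both ends of the edge form a lens with apex d = sqrt
    (R - c^2), Y = 0. The last clause is the squared form of the claim that this apex lies within
    sqrt R of the point given by \<open>a\<close> and \<open>y\<close>. The other two put that point
    into the disc with the edge as diameter, on the side of the origin.\<close>
  have T: "a\<^sup>2 + y\<^sup>2 \<le> 3/4 \<and> a \<ge> 0 \<and>
     (c\<^sup>2 - a\<^sup>2 - y\<^sup>2)\<^sup>2 \<ge> 4 * a\<^sup>2 * (R - c\<^sup>2)"
  \<comment> \<open>In the half-plane y >= 0 this line separates the points nearest to the vertex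
    \<open>e\<close> from those nearest to the vertex -1. The hypothesis on the nearest vertex,
    \<open>k2\<close> or \<open>k3\<close>, is the one that bites.\<close>
  proof (cases "y \<ge> - (2 * c) * x")
    case True
    have h: "0 \<le> y * (y + 2 * c * x)" using True y0 by (intro mult_nonneg_nonneg) auto
    define k where "k = sqrt (x\<^sup>2 + y\<^sup>2)"
    have kk: "k\<^sup>2 = x\<^sup>2 + y\<^sup>2" and k0: "k \<ge> 0" by (auto simp: k_def)
    \<comment> \<open>\<open>x + 2 * c * y\<close> is twice the inner product of the point with the
      unit vector at 60 degrees. In this sector the angle between them is at most 60 degrees, so it
      is at least the modulus \<open>k\<close>.\<close>
    have "x + 2 * c * y \<ge> 0"
    proof -
      have "2 * c * (- (2 * c) * x) \<le> 2 * c * y" using True c0 by (intro mult_left_mono) auto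
      also have "2 * c * (- (2 * c) * x) = - 3 * x" using c2 by algebra
      finally have "2 * c * y \<ge> -3 * x" .
      moreover have "2 * c * y \<ge> 0" using c0 y0 by simp
      ultimately show ?thesis by linarith
    qed
    moreover have "(x + 2 * c * y)\<^sup>2 = x\<^sup>2 + y\<^sup>2 + 2 * (y * (y + 2 * c * x))"
    proof -
      have "(x + 2 * c * y)\<^sup>2 = x\<^sup>2 + 4 * (c * c) * y\<^sup>2 + 4 * c * x * y"
        by (simp add: power2_eq_square algebra_simps)
      then show ?thesis unfolding c2 by (simp add: power2_eq_square algebra_simps)
    qed
    moreover from this have "k\<^sup>2 \<le> (x + 2 * c * y)\<^sup>2" using h kk by linarith
    ultimately have "k \<le> x + 2 * c * y" using power2_le_imp_le by blast
    moreover have "a\<^sup>2 + (c - y)\<^sup>2 = k\<^sup>2 + 1 - (x + 2 * c * y)"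
      using c2 kk by (simp add: a power2_eq_square algebra_simps)
    ultimately have "3 * k\<^sup>2 < k\<^sup>2 + 1 - k" using k2 k kk by (simp add: x_def)
    then have "(2 * k - 1) * (k + 1) < 0" by (simp add: power2_eq_square algebra_simps)
    then have k12: "k < 1/2" using k0 by (auto simp: mult_less_0_iff)
    have xk: "\<bar>x\<bar> \<le> k" using power2_le_imp_le[of "\<bar>x\<bar>" k] kk k0 by simp
    have kq: "k\<^sup>2 < 1/4" using power_strict_mono[OF k12 k0, of 2] by (simp add: power2_eq_square)
    have a0: "a \<ge> 0" using xk k12 by (simp add: a)
    have "- x \<le> 1/4"
    proof (cases "x \<ge> 0")
      case False
      have "0 \<le> 2 * c * (-x)" using False c0 by (intro mult_nonneg_nonneg) auto
      then have "(2 * c * (-x))\<^sup>2 \<le> y\<^sup>2" using True by (intro power_mono) auto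
      moreover have "(2 * c * (-x))\<^sup>2 = 3 * x\<^sup>2" using c2 by (simp add: power2_eq_square algebra_simps)
      ultimately have "3 * x\<^sup>2 \<le> y\<^sup>2" by linarith
      then have "(2 * (-x))\<^sup>2 \<le> k\<^sup>2" using kk by (simp add: power_mult_distrib)
      then have "2 * (-x) \<le> k" using k0 by (rule power2_le_imp_le)
      then show ?thesis using k12 by linarith
    qed auto
    then have T: "a\<^sup>2 + y\<^sup>2 \<le> 3/4" using kq kk
      by (simp add: a power2_eq_square algebra_simps)
    have "2 * c * a \<le> c + y" using True by (simp add: a algebra_simps)
    then have "(2 * c * a)\<^sup>2 \<le> (c + y)\<^sup>2" using a0 c0 by (intro power_mono) auto
    moreover have "(2 * c * a)\<^sup>2 = 3 * a\<^sup>2" using c2 by (simp add: power2_eq_square algebra_simps)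
    ultimately have "3 * a\<^sup>2 \<le> (c + y)\<^sup>2" by linarith
    then have "0 \<le> ((c + y)\<^sup>2 - 3 * a\<^sup>2) * (a\<^sup>2 + (c - y)\<^sup>2)" by simp
    also have "\<dots> = (c\<^sup>2 - a\<^sup>2 - y\<^sup>2)\<^sup>2 - 4 * a\<^sup>2 * (a\<^sup>2 + (c - y)\<^sup>2 - c\<^sup>2)"
      by (simp add: power2_eq_square algebra_simps)
    finally have "4 * a\<^sup>2 * (a\<^sup>2 + (c - y)\<^sup>2 - c\<^sup>2) \<le> (c\<^sup>2 - a\<^sup>2 - y\<^sup>2)\<^sup>2" by simp
    moreover have "4 * a\<^sup>2 * (R - c\<^sup>2) \<le> 4 * a\<^sup>2 * (a\<^sup>2 + (c - y)\<^sup>2 - c\<^sup>2)"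
      using k2 by (intro mult_left_mono) auto
    ultimately show ?thesis using T a0 by linarith
  next
    case False
    have x0: "x < 0"
    proof (rule ccontr)
      assume "\<not> x < 0"
      then have "2 * c * x \<ge> 0" using c0 by simp
      then show False using False y0 by linarith
    qed
    have "y\<^sup>2 \<le> (2 * c * (-x))\<^sup>2" using False y0 by (intro power_mono) auto
    moreover have "(2 * c * (-x))\<^sup>2 = 3 * x\<^sup>2" using c2 by (simp add: power2_eq_square algebra_simps)
    ultimately have yx: "y\<^sup>2 \<le> 3 * x\<^sup>2" by linarith
    have "3 * (x\<^sup>2 + y\<^sup>2) < (1 + x)\<^sup>2 + y\<^sup>2" using k k3 by (simp add: a)
    then have T: "a\<^sup>2 + y\<^sup>2 \<le> 3/4" by (simp add: a power2_eq_square algebra_simps)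
    have a0: "a > 0" using x0 by (simp add: a)
    have "0 \<le> (y\<^sup>2 - 3 * x\<^sup>2) * (y\<^sup>2 - (3/4 + 3 * a - a\<^sup>2))"
      using yx T a0 by (intro mult_nonpos_nonpos) auto
    also have "\<dots> = (3/4 - a\<^sup>2 - y\<^sup>2)\<^sup>2 - 4 * a\<^sup>2 * ((3/2 - a)\<^sup>2 + y\<^sup>2 - 3/4)"
      unfolding x_def power2_eq_square by algebra
    finally have "4 * a\<^sup>2 * ((3/2 - a)\<^sup>2 + y\<^sup>2 - 3/4) \<le> (3/4 - a\<^sup>2 - y\<^sup>2)\<^sup>2" by simp
    moreover have "4 * a\<^sup>2 * (R - 3/4) \<le> 4 * a\<^sup>2 * ((3/2 - a)\<^sup>2 + y\<^sup>2 - 3/4)"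
      using k3 by (intro mult_left_mono) auto
    ultimately have "4 * a\<^sup>2 * (R - 3/4) \<le> (3/4 - a\<^sup>2 - y\<^sup>2)\<^sup>2" by linarith
    moreover have cc: "c\<^sup>2 = 3/4" using c2 by (simp add: power2_eq_square)
    ultimately show ?thesis unfolding cc using T a0 by simp
  qed
  have c2': "c\<^sup>2 = 3/4" using c2 by (simp add: power2_eq_square)
  have "y\<^sup>2 \<le> c\<^sup>2" using T c2' zero_le_power2[of a] by linarith
  then have yc: "y \<le> c" using power2_le_imp_le[of y c] c0 by simp
  have "- (Y * y) \<le> \<bar>Y\<bar> * c"
    using mult_mono[OF order_refl[of "\<bar>Y\<bar>"] yc] y0 abs_ge_minus_self[of "Y * y"] by (simp add: abs_mult)
  moreover have "(d + a)\<^sup>2 + (Y - y)\<^sup>2 > d\<^sup>2 + (\<bar>Y\<bar> + c)\<^sup>2" using e far by linarith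
  then have "2 * a * d + a\<^sup>2 + y\<^sup>2 - 2 * (Y * y) > c\<^sup>2 + 2 * (\<bar>Y\<bar> * c)"
    by (simp add: power2_sum power2_diff algebra_simps)
  ultimately have "2 * a * d > c\<^sup>2 - a\<^sup>2 - y\<^sup>2" by linarith
  moreover have "c\<^sup>2 - a\<^sup>2 - y\<^sup>2 \<ge> 0" using T c2' by linarith
  ultimately have "(c\<^sup>2 - a\<^sup>2 - y\<^sup>2)\<^sup>2 < (2 * a * d)\<^sup>2" by (intro power_strict_mono) auto
  also have "\<dots> = 4 * a\<^sup>2 * d\<^sup>2" by (simp add: power_mult_distrib)
  also have "\<dots> \<le> 4 * a\<^sup>2 * (R - c\<^sup>2)"
  proof -
    have "c\<^sup>2 \<le> (\<bar>Y\<bar> + c)\<^sup>2" using c0 by (intro power_mono) auto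
    then have "d\<^sup>2 \<le> R - c\<^sup>2" using e by linarith
    then show ?thesis by (intro mult_left_mono) auto
  qed
  finally show False using T by linarith
qed

text \<open>The points 1, \<open>e * e\<close> and \<open>- e\<close> are the three cube roots of
  unity. Multiplication by \<open>cnj e\<close> makes the edge from 1 to \<open>e * e\<close>
  vertical with the real axis as axis of symmetry; conjugation then reduces the claim to a
  nonnegative imaginary part of \<open>K\<close>.\<close>

lemma no_far_vertex:
  fixes \<kappa> \<eta> :: complex and R :: real
  defines "e \<equiv> Complex (1/2) (sqrt 3 / 2)"
  assumes far: "cmod (\<kappa> - 1) > R" "cmod (\<kappa> - e * e) > R" "cmod (\<kappa> + e) > R" "cmod (\<eta> - \<kappa>) > R"
    and near: "cmod (\<eta> - 1) \<le> R" "cmod (\<eta> - e * e) \<le> R" "sqrt 3 * cmod \<kappa> \<le> R"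
  shows False
proof -
  define c where "c = sqrt 3 / 2"
  define r where "r = sqrt 3"
  have r2: "r * r = 3" and cr: "c = r / 2" by (simp_all add: r_def c_def)
  have e: "e = Complex (1/2) c" and e1: "cmod e = 1"
    by (simp_all add: e_def c_def cmod_def power_divide)
  have R0: "R \<ge> 0" using near(1) norm_ge_zero order_trans by blast
  define K where "K = \<kappa> * cnj e"
  define H where "H = \<eta> * cnj e"
  have ee: "e * cnj e = 1" using e1 complex_norm_square[of e] by simp
  have n: "cmod (z - z' * e) = cmod (z * cnj e - z')" for z z'
  proof -
    have "cmod (z - z' * e) = cmod ((z - z' * e) * cnj e)" using e1 by (simp add: norm_mult)
    also have "(z - z' * e) * cnj e = z * cnj e - z'" using ee by (simp add: algebra_simps)
    finally show ?thesis .
  qed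
  have e0: "1 = cnj e * e" using ee by (simp add: mult.commute)
  have f: "cmod (z - 1) = cmod (z * cnj e - cnj e)" "cmod (z - e * e) = cmod (z * cnj e - e)"
    "cmod (z + e) = cmod (z * cnj e + 1)" for z
    using n[of z "cnj e"] n[of z e] n[of z "-1"] e0 by (simp_all add: mult.commute)
  have g: "cmod (\<eta> - \<kappa>) = cmod (H - K)" "cmod \<kappa> = cmod K"
    using e1 by (simp_all add: H_def K_def norm_mult flip: left_diff_distrib)
  have sq: "cmod z > R \<longleftrightarrow> (cmod z)\<^sup>2 > R\<^sup>2" "cmod z \<le> R \<longleftrightarrow> (cmod z)\<^sup>2 \<le> R\<^sup>2" for z
    using R0 by (auto simp: abs_le_square_iff[symmetric] not_le[symmetric])
  define x where "x = Re K"
  define y where "y = Im K"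
  define d where "d = Re H - 1/2"
  define Y where "Y = Im H"
  have k: "(x - 1/2)\<^sup>2 + (y + c)\<^sup>2 > R\<^sup>2" "(x - 1/2)\<^sup>2 + (y - c)\<^sup>2 > R\<^sup>2" "(x + 1)\<^sup>2 + y\<^sup>2 > R\<^sup>2"
    using far(1-3) unfolding f sq cmod_power2 K_def[symmetric] by (simp_all add: x_def y_def e)
  have h: "d\<^sup>2 + (Y + c)\<^sup>2 \<le> R\<^sup>2" "d\<^sup>2 + (Y - c)\<^sup>2 \<le> R\<^sup>2"
    using near(1,2) unfolding f sq cmod_power2 H_def[symmetric] by (simp_all add: d_def Y_def e)
  have hk: "(d + 1/2 - x)\<^sup>2 + (Y - y)\<^sup>2 > R\<^sup>2"
    using far(4) unfolding g sq cmod_power2 by (simp add: x_def y_def d_def Y_def)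
  have "(sqrt 3 * cmod \<kappa>)\<^sup>2 \<le> R\<^sup>2" using near(3) by (intro power_mono) auto
  then have kk: "3 * (x\<^sup>2 + y\<^sup>2) \<le> R\<^sup>2"
    by (simp add: g power_mult_distrib cmod_power2 x_def y_def)
  have hY: "d\<^sup>2 + (\<bar>Y\<bar> + c)\<^sup>2 \<le> R\<^sup>2"
    using h by (cases "Y \<ge> 0") (auto simp: power2_commute algebra_simps)
  show False
  proof (cases "y \<ge> 0")
    case True
    show False
      by (rule no_far_vertex_aux[OF True, where a = "1/2 - x" and R = "R\<^sup>2" and d = d and Y = Y])
         (use k hk kk hY in \<open>simp_all add: c_def power2_commute algebra_simps\<close>)
  next
    case False
    then have "-y \<ge> 0" by simp
    then show False
      by (rule no_far_vertex_aux[where a = "1/2 - x" and R = "R\<^sup>2" and d = d and Y = "-Y"])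
         (use k hk kk hY in \<open>simp_all add: c_def power2_commute algebra_simps\<close>)
  qed
qed

section \<open>Geometry of products with powers of a primitive cube root of unity\<close>

definition omega :: complex where "omega = Complex (- 1/2) (sqrt 3 / 2)"

lemma omega_sq: "omega * omega = - 1 - omega"
  by (simp add: omega_def complex_eq_iff)

lemma omega_cube: "omega ^ 3 = 1"
  by (simp add: omega_def complex_eq_iff power3_eq_cube)

lemma cmod_omega: "cmod omega = 1"
  by (simp add: omega_def cmod_def power_divide)

lemma cmod_one_minus_omega: "cmod (1 - omega) = sqrt 3"
  by (simp add: omega_def cmod_def power_divide)

lemma no_parallelogram_complex:
  fixes m a b :: complex
  assumes "cmod (a + b) \<le> sqrt 3" "cmod (sqrt 3 * m - \<i> * a) \<le> sqrt 3" "cmod (sqrt 3 * m - \<i> * b) \<le> sqrt 3"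
    and "cmod (m + a) > sqrt 3" "cmod (m - a) > sqrt 3" "cmod (m + b) > sqrt 3" "cmod (m - b) > sqrt 3"
  shows False
proof -
  have sq: "cmod z \<le> sqrt 3 \<longleftrightarrow> (cmod z)\<^sup>2 \<le> 3" for z
    using abs_le_square_iff[of "cmod z" "sqrt 3"] by simp
  then have sq': "cmod z > sqrt 3 \<longleftrightarrow> (cmod z)\<^sup>2 > 3" for z by (simp add: not_le[symmetric])
  show False
    using no_parallelogram[of "Re a" "Re b" "Im a" "Im b" "Re m" "Im m"] assms
    unfolding sq sq' cmod_power2 by simp
qed

text \<open>Write A, B, C, D for the four products. Since A + omega D = omega B + C, these four
  points are the vertices of a parallelogram with centre \<open>m\<close> and half-diagonals
  \<open>a\<close>, \<open>b\<close>. The three upper bounds required by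
  \<open>no_parallelogram_complex\<close> are bounds on \<open>(1 - omega) * z\<close> for
  \<open>z\<close> equal to \<open>w\<close>, \<open>v\<close> and \<open>u * omega\<close>.\<close>

lemma no_two_pairs:
  assumes uvw: "cmod u \<le> 1" "cmod v \<le> 1" "cmod w \<le> 1"
    and A: "cmod (u + v + w) > sqrt 3" and B: "cmod (u + v * omega + w * omega\<^sup>2) > sqrt 3"
    and C: "cmod (u + v + w * omega) > sqrt 3" and D: "cmod (u + v * omega + w) > sqrt 3"
  shows False
proof -
  \<comment> \<open>\<open>P\<close> is exp (i pi / 6), the unimodular number with P (sqrt 3 - i) =
    2. It turns sqrt 3 m - i a, and likewise the expression with b, into a difference of two rotated
    products in which two of the three entries cancel.\<close>
  define P where "P = Complex (sqrt 3 / 2) (1 / 2)"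
  define m where "m = (u + v + w + omega * (u + v * omega + w)) / 2"
  define a where "a = (u + v + w - omega * (u + v * omega + w)) / 2"
  define b where "b = (omega * (u + v * omega + w * omega\<^sup>2) - (u + v + w * omega)) / 2"
  have w3: "omega * omega = - 1 - omega" by (rule omega_sq)
  have P1: "cmod P = 1" by (simp add: P_def cmod_def power_divide)
  have Pi: "P * (complex_of_real (sqrt 3) - \<i>) = 2" "P * (complex_of_real (sqrt 3) + \<i>) * omega = - 2"
    by (simp_all add: P_def omega_def complex_eq_iff algebra_simps)
  have n1: "cmod ((1 - omega) * z) \<le> sqrt 3" if "cmod z \<le> 1" for z
    using that by (simp add: norm_mult cmod_one_minus_omega)
  have "(complex_of_real (sqrt 3) * m - \<i> * a) * P = (1 - omega) * v"
  proof -
    have "2 * ((complex_of_real (sqrt 3) * m - \<i> * a) * P) =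
        (u + v + w) * (P * (complex_of_real (sqrt 3) - \<i>)) +
        (u + v * omega + w) * (P * (complex_of_real (sqrt 3) + \<i>) * omega)"
      by (simp add: m_def a_def field_simps)
    also have "\<dots> = 2 * ((1 - omega) * v)" unfolding Pi by (simp add: algebra_simps)
    finally show ?thesis by (subst (asm) mult_cancel_left) simp
  qed
  then have 2: "cmod (complex_of_real (sqrt 3) * m - \<i> * a) = cmod ((1 - omega) * v)"
    using P1 by (metis mult.right_neutral norm_mult)
  have mb: "m = (omega * (u + v * omega + w * omega\<^sup>2) + (u + v + w * omega)) / 2"
    unfolding m_def power2_eq_square using w3 by algebra
  have "(complex_of_real (sqrt 3) * m - \<i> * b) * P = (1 - omega) * (u * omega)"
  proof -
    define p where "p = P * (complex_of_real (sqrt 3) - \<i>)"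
    define q where "q = P * (complex_of_real (sqrt 3) + \<i>)"
    have eq: "2 * ((complex_of_real (sqrt 3) * m - \<i> * b) * P) =
        omega * (u + v * omega + w * omega\<^sup>2) * p + (u + v + w * omega) * q"
      by (simp add: mb b_def p_def q_def field_simps)
    have "p = 2" and q: "q * omega = -2" using Pi by (simp_all add: p_def q_def)
    have "q = (q * omega) * omega\<^sup>2"
      using omega_cube by (simp add: power3_eq_cube power2_eq_square mult.assoc)
    then have "q = - 2 * omega\<^sup>2" unfolding q .
    with eq show ?thesis using \<open>p = 2\<close> w3 unfolding power2_eq_square by algebra
  qed
  then have 3: "cmod (complex_of_real (sqrt 3) * m - \<i> * b) = cmod ((1 - omega) * (u * omega))"
    using P1 by (metis mult.right_neutral norm_mult)
  have "2 * (a + b) = (u + v + w - omega * (u + v * omega + w))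
      + (omega * (u + v * omega + w * omega\<^sup>2) - (u + v + w * omega))"
    unfolding a_def b_def by (simp only: add_divide_distrib[symmetric]) simp
  also have "\<dots> = 2 * ((1 - omega) * w)" unfolding power2_eq_square using w3 by algebra
  finally have "a + b = (1 - omega) * w" by (subst (asm) mult_cancel_left) simp
  then have 1: "cmod (a + b) \<le> sqrt 3" using n1 uvw by simp
  have half: "(p + q) / 2 + (p - q) / 2 = p" "(p + q) / 2 - (p - q) / 2 = q" for p q :: complex
    by (simp_all add: field_simps)
  have "m + a = u + v + w" "m - a = omega * (u + v * omega + w)"
    unfolding m_def a_def by (rule half)+
  moreover have "m + b = omega * (u + v * omega + w * omega\<^sup>2)" "m - b = u + v + w * omega"
    unfolding mb b_def by (rule half)+
  ultimately show False
    using no_parallelogram_complex[of a b m] 1 2 3 n1[of v] n1[of "u * omega"] uvw A B C D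
    by (simp add: norm_mult cmod_omega)
qed

text \<open>Parseval on Z_3: the three squared moduli add up to 3 (|u|^2 + |v|^2 + |w|^2) <= 9, so
  they cannot all exceed 3.\<close>

lemma no_full_line:
  assumes uvw: "cmod u \<le> 1" "cmod v \<le> 1" "cmod w \<le> 1"
    and A: "cmod (u + v + w) > sqrt 3" and B: "cmod (u + v * omega + w * omega\<^sup>2) > sqrt 3"
    and C: "cmod (u + v * omega\<^sup>2 + w * omega) > sqrt 3"
  shows False
proof -
  have sq: "cmod z > sqrt 3 \<Longrightarrow> (cmod z)\<^sup>2 > 3" for z
    by (metis abs_norm_cancel real_sqrt_abs real_sqrt_less_iff)
  have "complex_of_real ((cmod (u + v + w))\<^sup>2 + (cmod (u + v * omega + w * omega\<^sup>2))\<^sup>2 + (cmod (u + v * omega\<^sup>2 + w * omega))\<^sup>2)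
     = complex_of_real (3 * ((cmod u)\<^sup>2 + (cmod v)\<^sup>2 + (cmod w)\<^sup>2))"
  proof -
    have c: "cnj omega = - 1 - omega" by (simp add: omega_def complex_eq_iff)
    show ?thesis
      unfolding of_real_add of_real_mult complex_norm_square complex_cnj_add complex_cnj_mult complex_cnj_power c
      using omega_sq unfolding power2_eq_square of_real_numeral by algebra
  qed
  then have "(cmod (u + v + w))\<^sup>2 + (cmod (u + v * omega + w * omega\<^sup>2))\<^sup>2 + (cmod (u + v * omega\<^sup>2 + w * omega))\<^sup>2
     = 3 * ((cmod u)\<^sup>2 + (cmod v)\<^sup>2 + (cmod w)\<^sup>2)" by (simp only: of_real_eq_iff)
  moreover have "(cmod u)\<^sup>2 \<le> 1" "(cmod v)\<^sup>2 \<le> 1" "(cmod w)\<^sup>2 \<le> 1"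
    using uvw by (simp_all add: power_le_one)
  ultimately show False using sq[OF A] sq[OF B] sq[OF C] by argo
qed

text \<open>After division by \<open>m = u + v\<close> the hypotheses \<open>A\<close> keep
  \<open>- w / m\<close> away from all three cube roots of unity, and \<open>D\<close> keeps it away
  from \<open>(u + v * omega) / m\<close>. The latter point is close to 1 and to
  \<open>omega\<close>, because its differences from them are multiples of \<open>1 - omega\<close>.
  This is the configuration of \<open>no_far_vertex\<close>.\<close>

lemma full_coset_isolated:
  assumes uvw: "cmod u \<le> 1" "cmod v \<le> 1" "cmod w \<le> 1"
    and A: "cmod (u + v + w) > sqrt 3" "cmod (u + v + w * omega) > sqrt 3" "cmod (u + v + w * omega\<^sup>2) > sqrt 3"
    and D: "cmod (u + v * omega + w) > sqrt 3"
  shows False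
proof -
  define m where "m = u + v"
  define M where "M = cmod m"
  have "sqrt 3 > 1" by simp
  then have "cmod w < sqrt 3" using uvw by linarith
  then have "m \<noteq> 0" using A(1) unfolding m_def by auto
  then have M0: "M > 0" by (simp add: M_def)
  define e where "e = Complex (1/2) (sqrt 3 / 2)"
  have e: "e * e = omega" "- e = omega\<^sup>2"
    by (simp_all add: e_def omega_def complex_eq_iff power2_eq_square)
  then have e': "e = - (omega\<^sup>2)" by (metis minus_minus)
  have div: "cmod (z / m) = cmod z / M" for z by (simp add: norm_divide M_def)
  have gt: "cmod (z / m) > sqrt 3 / M" if "cmod z > sqrt 3" for z
    using that M0 unfolding div by (simp add: divide_strict_right_mono)
  have le: "cmod (z / m) \<le> sqrt 3 / M" if "cmod z \<le> sqrt 3" for z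
    using that M0 unfolding div by (simp add: divide_right_mono)
  have rot: "cmod (z * omega) = cmod z" "cmod (z * omega\<^sup>2) = cmod z" for z
    by (simp_all add: norm_mult norm_power cmod_omega)
  have n1: "cmod ((1 - omega) * z) \<le> sqrt 3" if "cmod z \<le> 1" for z
    using that by (simp add: norm_mult cmod_one_minus_omega)
  note w2 = omega_sq
  have w1: "omega * (omega * omega) = 1" using omega_cube by (simp add: power3_eq_cube mult.assoc)
  have "cmod (- w / m - 1) > sqrt 3 / M"
  proof -
    have "- w / m - 1 = - ((m + w) / m)" using \<open>m \<noteq> 0\<close> by (simp add: field_simps)
    then show ?thesis using gt[of "m + w"] A(1) by (simp only: norm_minus_cancel) (simp add: m_def)
  qed
  moreover have "cmod (- w / m - e * e) > sqrt 3 / M"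
  proof -
    have "- w / m - e * e = - (((m + w * omega\<^sup>2) * omega) / m)"
      unfolding e using \<open>m \<noteq> 0\<close> w1 by (simp add: field_simps power2_eq_square)
    then show ?thesis using gt[of "(m + w * omega\<^sup>2) * omega"] A(3)
      by (simp only: norm_minus_cancel rot) (simp add: m_def)
  qed
  moreover have "cmod (- w / m + e) > sqrt 3 / M"
  proof -
    have "- w / m + e = - (((m + w * omega) * omega\<^sup>2) / m)"
      unfolding e' using \<open>m \<noteq> 0\<close> w1 by (simp add: field_simps power2_eq_square)
    then show ?thesis using gt[of "(m + w * omega) * omega\<^sup>2"] A(2)
      by (simp only: norm_minus_cancel rot) (simp add: m_def)
  qed
  moreover have "cmod ((u + v * omega) / m - - w / m) > sqrt 3 / M"
    using gt[OF D] by (simp add: diff_divide_distrib add_divide_distrib)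
  moreover have "cmod ((u + v * omega) / m - 1) \<le> sqrt 3 / M"
  proof -
    have "(u + v * omega) / m - 1 = - (((1 - omega) * v) / m)"
      using \<open>m \<noteq> 0\<close> by (simp add: field_simps m_def)
    then show ?thesis using le[OF n1[OF uvw(2)]] by (simp only: norm_minus_cancel)
  qed
  moreover have "cmod ((u + v * omega) / m - e * e) \<le> sqrt 3 / M"
  proof -
    have "(u + v * omega) / m - e * e = ((1 - omega) * u) / m"
      unfolding e using \<open>m \<noteq> 0\<close> by (simp add: field_simps m_def)
    then show ?thesis using le[OF n1[OF uvw(1)]] by simp
  qed
  moreover have "sqrt 3 * cmod (- w / m) \<le> sqrt 3 / M"
    using uvw(3) M0 by (simp add: div norm_divide M_def divide_right_mono)
  ultimately show False by (rule no_far_vertex[where R = "sqrt 3 / M", folded e_def])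
qed

section \<open>Index sets of large products in the affine plane Z_3^2\<close>

definition exceeds :: "complex \<Rightarrow> complex \<Rightarrow> complex \<Rightarrow> nat \<Rightarrow> nat \<Rightarrow> bool" where
  "exceeds u v w j k \<longleftrightarrow> sqrt 3 < cmod (u + v * omega ^ j + w * omega ^ k)"

lemma exceeds_shift: "exceeds u v w (j + j') (k + k') = exceeds u (v * omega ^ j) (w * omega ^ k) j' k'"
  by (simp add: exceeds_def power_add mult.assoc)

lemma exceeds_period:
  "exceeds u v w 3 k = exceeds u v w 0 k" "exceeds u v w 4 k = exceeds u v w 1 k"
  "exceeds u v w j 3 = exceeds u v w j 0" "exceeds u v w j 4 = exceeds u v w j 1"
  "exceeds u v w j 5 = exceeds u v w j 2" "exceeds u v w j 6 = exceeds u v w j 0"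
proof -
  have "omega ^ 4 = omega" "omega ^ 5 = omega\<^sup>2" "omega ^ 6 = 1"
    using omega_cube power_add[of omega 3 1] power_add[of omega 3 2] power_add[of omega 3 3] by simp_all
  then show "exceeds u v w 3 k = exceeds u v w 0 k" "exceeds u v w 4 k = exceeds u v w 1 k"
  "exceeds u v w j 3 = exceeds u v w j 0" "exceeds u v w j 4 = exceeds u v w j 1"
  "exceeds u v w j 5 = exceeds u v w j 2" "exceeds u v w j 6 = exceeds u v w j 0"
    using omega_cube by (simp_all add: exceeds_def)
qed

text \<open>A common factor \<open>omega ^ n\<close> leaves the modulus unchanged, so permuting the
  entries acts on the indices by linear maps modulo 3, where 2 is -1. These maps preserve the
  direction (1, 2) and permute (0, 1), (1, 0) and (1, 1), so one representative of each forbidden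
  configuration is enough.\<close>

lemma exceeds_permute:
  "exceeds v w u j k = exceeds u v w (2 * k) (j + 2 * k)"
  "exceeds w u v j k = exceeds u v w (2 * j + k) (2 * j)"
  "exceeds u w v j k = exceeds u v w k j"
  "exceeds v u w j k = exceeds u v w (2 * j) (2 * j + k)"
  "exceeds w v u j k = exceeds u v w (j + 2 * k) (2 * k)"
proof -
  have c: "omega ^ n * (omega ^ n * omega ^ n) = 1" for n
  proof -
    have "(omega ^ n) ^ 3 = (omega ^ 3) ^ n" by (metis mult.commute power_mult)
    then have "(omega ^ n) ^ 3 = 1" by (simp only: omega_cube power_one)
    then show ?thesis by (simp only: power3_eq_cube mult.assoc)
  qed
  have r: "cmod z = cmod z'" if "z = omega ^ n * z'" for z z' n
    unfolding that norm_mult norm_power cmod_omega by simp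
  define a where "a = omega ^ j"
  define b where "b = omega ^ k"
  have ab: "a * (a * a) = 1" "b * (b * b) = 1" using c by (simp_all add: a_def b_def)
  have pow: "omega ^ (2 * k) = b * b" "omega ^ (2 * j) = a * a" "omega ^ (j + 2 * k) = a * (b * b)"
    "omega ^ (2 * j + k) = a * a * b" "omega ^ j = a" "omega ^ k = b"
    by (simp_all add: a_def b_def power_add mult_2)
  show "exceeds u w v j k = exceeds u v w k j"
    by (simp add: exceeds_def algebra_simps)
  have "v + w * a + u * b = b * (u + v * (b * b) + w * (a * (b * b)))" using ab(2) by algebra
  from r[of _ k, folded b_def, OF this] show "exceeds v w u j k = exceeds u v w (2 * k) (j + 2 * k)"
    unfolding exceeds_def pow by simp
  have "w + u * a + v * b = a * (u + v * (a * a * b) + w * (a * a))" using ab(1) by algebra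
  from r[of _ j, folded a_def, OF this] show "exceeds w u v j k = exceeds u v w (2 * j + k) (2 * j)"
    unfolding exceeds_def pow by simp
  have "v + u * a + w * b = a * (u + v * (a * a) + w * (a * a * b))" using ab(1) by algebra
  from r[of _ j, folded a_def, OF this] show "exceeds v u w j k = exceeds u v w (2 * j) (2 * j + k)"
    unfolding exceeds_def pow by simp
  have "w + v * a + u * b = b * (u + v * (a * (b * b)) + w * (b * b))" using ab(2) by algebra
  from r[of _ k, folded b_def, OF this] show "exceeds w v u j k = exceeds u v w (j + 2 * k) (2 * k)"
    unfolding exceeds_def pow by simp
qed

text \<open>
  Indices are read modulo 3. A line of direction (1, 2) is not full (first clause); two such lines
  do not contain two points each (next three clauses); a full line of any other direction excludes
  further points (last three clauses).
\<close>

definition sparse_at :: "(nat \<Rightarrow> nat \<Rightarrow> bool) \<Rightarrow> nat \<Rightarrow> nat \<Rightarrow> bool" where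
  "sparse_at e j k \<longleftrightarrow>
     \<not> (e j k \<and> e (j + 1) (k + 2) \<and> e (j + 2) (k + 1)) \<and>
     \<not> (e j k \<and> e (j + 1) (k + 2) \<and> e j (k + 1) \<and> e (j + 1) k) \<and>
     \<not> (e j k \<and> e (j + 1) (k + 2) \<and> e (j + 1) k \<and> e (j + 2) (k + 2)) \<and>
     \<not> (e j k \<and> e (j + 1) (k + 2) \<and> e (j + 2) (k + 2) \<and> e j (k + 1)) \<and>
     \<not> (e j k \<and> e j (k + 1) \<and> e j (k + 2) \<and> (e (j + 1) k \<or> e (j + 2) (k + 2))) \<and>
     \<not> (e j k \<and> e (j + 1) k \<and> e (j + 2) k \<and> (e j (k + 1) \<or> e (j + 2) (k + 2))) \<and>
     \<not> (e j k \<and> e (j + 1) (k + 1) \<and> e (j + 2) (k + 2) \<and> (e j (k + 1) \<or> e (j + 1) k))"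

definition sparse :: "(nat \<Rightarrow> nat \<Rightarrow> bool) \<Rightarrow> bool" where
  "sparse e \<longleftrightarrow> (\<forall>j k. sparse_at e j k)"

lemma sparse_exceeds:
  assumes "cmod u \<le> 1" "cmod v \<le> 1" "cmod w \<le> 1"
  shows "sparse (exceeds u v w)"
proof -
  have lines: "\<not> (exceeds u v w 0 0 \<and> exceeds u v w 1 2 \<and> exceeds u v w 2 1)"
    and pairs: "\<not> (exceeds u v w 0 0 \<and> exceeds u v w 1 2 \<and> exceeds u v w 0 1 \<and> exceeds u v w 1 0)"
    and coset: "\<not> (exceeds u v w 0 0 \<and> exceeds u v w 0 1 \<and> exceeds u v w 0 2 \<and> exceeds u v w 1 0)"
    if "cmod u \<le> 1" "cmod v \<le> 1" "cmod w \<le> 1" for u v w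
    using no_full_line[OF that] no_two_pairs[OF that] full_coset_isolated[OF that]
    by (auto simp: exceeds_def)
  \<comment> \<open>Each clause at (0, 0) is one of \<open>lines\<close>, \<open>pairs\<close>,
    \<open>coset\<close> for a permuted triple. Other base points follow by absorbing powers of
    \<open>omega\<close> into \<open>v\<close> and \<open>w\<close>.\<close>
  have base: "sparse_at e 0 0"
    if e: "e = exceeds u v w" and n: "cmod u \<le> 1" "cmod v \<le> 1" "cmod w \<le> 1" for e u v w
  proof -
    note cyc = exceeds_permute[where u = u and v = v and w = w]
    have "exceeds u v w j (Suc (Suc 0)) = exceeds u v w j 2" "exceeds u v w (Suc (Suc 0)) j = exceeds u v w 2 j" for j
      by (simp_all add: numeral_2_eq_2)
    note per = exceeds_period[of u v w] this
    have "\<not> (e 0 0 \<and> e 1 2 \<and> e 1 0 \<and> e 2 2)" "\<not> (e 0 0 \<and> e 1 2 \<and> e 2 2 \<and> e 0 1)"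
      using pairs[OF n(2,3,1)] pairs[OF n(3,1,2)] unfolding e cyc
      by (auto simp: per simp del: One_nat_def)
    moreover have "\<not> (e 0 0 \<and> e 0 1 \<and> e 0 2 \<and> (e 1 0 \<or> e 2 2))"
      using coset[OF n] coset[OF n(2,1,3)] unfolding e cyc
      by (auto simp: per simp del: One_nat_def)
    moreover have "\<not> (e 0 0 \<and> e 1 0 \<and> e 2 0 \<and> (e 0 1 \<or> e 2 2))"
      using coset[OF n(1,3,2)] coset[OF n(3,1,2)] unfolding e cyc
      by (auto simp: per simp del: One_nat_def)
    moreover have "\<not> (e 0 0 \<and> e 1 1 \<and> e 2 2 \<and> (e 0 1 \<or> e 1 0))"
      using coset[OF n(2,3,1)] coset[OF n(3,2,1)] unfolding e cyc
      by (auto simp: per simp del: One_nat_def)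
    ultimately show ?thesis using lines[OF n] pairs[OF n] unfolding sparse_at_def e add_0 by blast
  qed
  show ?thesis
    unfolding sparse_def
  proof (intro allI, goal_cases)
    case (1 j k)
    define x where "x = exceeds u (v * omega ^ j) (w * omega ^ k)"
    have x: "exceeds u v w (j + j') (k + k') = x j' k'" for j' k'
      by (simp add: x_def exceeds_shift)
    note x' = x x[of 0, unfolded add_0_right] x[of _ 0, unfolded add_0_right] x[of 0 0, unfolded add_0_right]
    have "cmod (v * omega ^ j) \<le> 1" "cmod (w * omega ^ k) \<le> 1"
      using assms by (simp_all add: norm_mult norm_power cmod_omega)
    from base[OF x_def assms(1) this] show ?case unfolding sparse_at_def add_0 x' .
  qed
qed

text \<open>The reason behind the propositional check: on the three parallel lines of direction (1,
  2) a sparse set has at most 2 + 1 + 1 points, so a cover of eight points is a partition into two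
  sets of four. The line through (0, 0) offers only two of the eight points; hence each set has one
  point there, p and p', and the two sets have their pairs on different ones of the other two lines.
  Let q and r be the points missing from these pairs on their lines. Points taken one from each line
  are collinear iff they sum to 0. As neither set contains a full line, p + q + r = 0 = p' + q + r,
  so p = p', a contradiction.\<close>

lemma two_sparse_not_cover:
  assumes sp: "sparse e" "sparse e'"
    and per: "\<And>k. e 3 k = e 0 k" "\<And>k. e 4 k = e 1 k" "\<And>j. e j 3 = e j 0" "\<And>j. e j 4 = e j 1"
    and per': "\<And>k. e' 3 k = e' 0 k" "\<And>k. e' 4 k = e' 1 k" "\<And>j. e' j 3 = e' j 0" "\<And>j. e' j 4 = e' j 1"
    and cover: "e 0 1 \<or> e' 0 1" "e 0 2 \<or> e' 0 2" "e 1 0 \<or> e' 1 0" "e 1 1 \<or> e' 1 1"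
      "e 1 2 \<or> e' 1 2" "e 2 0 \<or> e' 2 0" "e 2 1 \<or> e' 2 1" "e 2 2 \<or> e' 2 2"
  shows False
proof -
  let ?S = "{0, 1, 2 :: nat}"
  have h: "\<forall>j\<in>?S. \<forall>k\<in>?S. sparse_at e j k" "\<forall>j\<in>?S. \<forall>k\<in>?S. sparse_at e' j k"
    using sp by (simp_all add: sparse_def)
  \<comment> \<open>All indices that occur are at most 4, so the periodicity rules reduce everything
    to nine propositional variables for each of the two sets.\<close>
  have n: "(0::nat) + 1 = 1" "(0::nat) + 2 = 2" "(1::nat) + 1 = 2" "(1::nat) + 2 = 3" "(2::nat) + 1 = 3" "(2::nat) + 2 = 4"
    by simp_all
  show False
    using cover h
    unfolding ball_simps sparse_at_def n per per'
    by sat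
qed

text \<open>The witness is \<open>u = exp (i (\<phi> - \<pi>/6))\<close> with \<open>s = sin \<phi>\<close>; four of the eight moduli are then equal to \<open>sqrt 3\<close>.\<close>

lemma hexagon_points:
  fixes s :: real
  assumes s: "0 \<le> s" "s \<le> 1/2"
  obtains u where "cmod u = 1"
    "\<And>j k. j < 3 \<Longrightarrow> k < 3 \<Longrightarrow> (j, k) \<noteq> (0, 0) \<Longrightarrow>
       cmod (u + cnj u * omega ^ j + of_real (2 * s) * omega ^ k) \<le> sqrt 3"
proof -
  define c where "c = sqrt (1 - s\<^sup>2)"
  define r where "r = sqrt 3"
  have r2: "r * r = 3" and r0: "r > 0" by (simp_all add: r_def)
  have ss: "s * s \<le> 1 / 4" using mult_mono[OF s(2) s(2)] s by simp
  have c2: "c * c = 1 - s * s" using ss by (simp add: c_def power2_eq_square)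
  have c0: "c \<ge> 0" using ss by (simp add: c_def power2_eq_square)
  have src: "s \<le> r * c"
  proof (rule power2_le_imp_le)
    have "(r * c)\<^sup>2 = (r * r) * (c * c)" by (simp add: power2_eq_square algebra_simps)
    then show "s\<^sup>2 \<le> (r * c)\<^sup>2" using ss unfolding r2 c2 by (simp add: power2_eq_square)
  qed (use r0 c0 in simp)
  \<comment> \<open>This choice closes the lengths 1, 1 and 2 s to an isosceles triangle, that is,
    \<open>z 1 2 = 0\<close> below. The index (0, 0) has to be left out: there the sum is
    \<open>r * c + 3 * s\<close>, which exceeds sqrt 3 as soon as s > 0.\<close>
  define u where "u = Complex (r / 2 * c + s / 2) (r / 2 * s - c / 2)"
  have om: "omega = Complex (-1/2) (r/2)" "omega ^ 2 = Complex (-1/2) (-r/2)"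
    by (simp_all add: omega_def r_def power2_eq_square complex_eq_iff)
  have u: "cmod u = 1"
  proof -
    have "(cmod u)\<^sup>2 = ((r * r) * (c * c) + s * s + (r * r) * (s * s) + c * c) / 4"
      unfolding cmod_power2 u_def by (simp add: power2_eq_square field_simps)
    then have "(cmod u)\<^sup>2 = 1" unfolding r2 c2 by simp
    then show ?thesis by (metis norm_ge_zero power2_eq_1_iff less_le_not_le neg_0_le_iff_le zero_neq_one not_one_le_zero)
  qed
  have sq: "cmod z \<le> sqrt 3 \<longleftrightarrow> (Re z)\<^sup>2 + (Im z)\<^sup>2 \<le> 3" for z
    using abs_le_square_iff[of "cmod z" "sqrt 3"] by (simp add: cmod_power2)
  define z where "z j k = u + cnj u * omega ^ j + of_real (2 * s) * omega ^ k" for j k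
  have rr: "r * (r * x) = 3 * x" "x * (r * r) = 3 * x" for x using r2 by simp_all
  have zs: "z 0 1 = Complex (r * c) (r * s)" "z 0 2 = Complex (r * c) (- r * s)"
    "z 1 0 = Complex (3 * s) (r * s)" "z 1 1 = Complex 0 (2 * r * s)" "z 1 2 = 0"
    "z 2 0 = Complex ((r * c + 3 * s) / 2) ((r * s - 3 * c) / 2)"
    "z 2 1 = Complex ((r * c - 3 * s) / 2) ((3 * r * s - 3 * c) / 2)"
    "z 2 2 = Complex ((r * c - 3 * s) / 2) (- (r * s + 3 * c) / 2)"
    unfolding z_def u_def om(2) unfolding om(1) power_0 power_one_right
    by (simp_all add: complex_eq_iff field_simps rr)
  have sq2: "(r * x)\<^sup>2 = 3 * x\<^sup>2" "c\<^sup>2 = 1 - s\<^sup>2" for x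
    using r2 c2 by (simp_all add: power2_eq_square)
  have "(r * c)\<^sup>2 + (r * s)\<^sup>2 = 3" "(r * c)\<^sup>2 + (- r * s)\<^sup>2 = 3"
    "(3 * s)\<^sup>2 + (r * s)\<^sup>2 = 12 * (s * s)" "0\<^sup>2 + (2 * r * s)\<^sup>2 = 12 * (s * s)"
    "0\<^sup>2 + 0\<^sup>2 = (0::real)"
    "((r * c + 3 * s) / 2)\<^sup>2 + ((r * s - 3 * c) / 2)\<^sup>2 = 3"
    "((r * c - 3 * s) / 2)\<^sup>2 + (- (r * s + 3 * c) / 2)\<^sup>2 = 3"
    "((r * c - 3 * s) / 2)\<^sup>2 + ((3 * r * s - 3 * c) / 2)\<^sup>2 = 3 - 6 * (s * (r * c - s))"
    using c2 by (simp_all add: power2_eq_square field_simps rr)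
  moreover have "s * (r * c - s) \<ge> 0" using src s by simp
  ultimately have *: "cmod (z 0 1) \<le> sqrt 3" "cmod (z 0 2) \<le> sqrt 3" "cmod (z 1 0) \<le> sqrt 3"
    "cmod (z 1 1) \<le> sqrt 3" "cmod (z 1 2) \<le> sqrt 3" "cmod (z 2 0) \<le> sqrt 3" "cmod (z 2 1) \<le> sqrt 3"
    "cmod (z 2 2) \<le> sqrt 3"
    unfolding sq zs complex.sel zero_complex.sel using ss by linarith+
  have "cmod (z j k) \<le> sqrt 3" if "j < 3" "k < 3" "(j, k) \<noteq> (0, 0)" for j k
  proof -
    have "j = 0 \<or> j = 1 \<or> j = 2" "k = 0 \<or> k = 1 \<or> k = 2" using that by auto
    then show ?thesis using that(3) * by auto
  qed
  then show ?thesis using that u unfolding z_def by blast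
qed

text \<open>With the phases removed, the row is (|A| - |B|) (1, 0, 0) + |B| (1, 1, 2 s), where 2 s =
  |C| / |B| <= 1 by the sorting. \<open>hexagon_points\<close> bounds the second part by |B| sqrt 3
  and the first is at most |A| - |B|, so the total is at most |A| sqrt 3.\<close>

lemma row_exceeds_at_most_once:
  assumes "cmod A \<le> 1" "cmod B \<le> cmod A" "cmod C \<le> cmod B"
  obtains X Y Z where "cmod X = 1" "cmod Y = 1" "cmod Z = 1"
    "\<And>j k. j < 3 \<Longrightarrow> k < 3 \<Longrightarrow> (j, k) \<noteq> (0, 0) \<Longrightarrow> \<not> exceeds (A * X) (B * Y) (C * Z) j k"
proof (cases "B = 0")
  case True
  then have "C = 0" using assms by simp
  have "(1::real) < sqrt 3" by simp
  then have "cmod A \<le> sqrt 3" using assms(1) by linarith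
  then show ?thesis using that[of 1 1 1] True \<open>C = 0\<close> by (auto simp: exceeds_def)
next
  case False
  define \<beta> where "\<beta> = cmod B"
  have b0: "\<beta> > 0" using False by (simp add: \<beta>_def)
  define s where "s = cmod C / (2 * \<beta>)"
  have s: "0 \<le> s" "s \<le> 1/2" using assms b0 by (simp_all add: s_def \<beta>_def field_simps)
  obtain u where u: "cmod u = 1"
    and hex: "\<And>j k. j < 3 \<Longrightarrow> k < 3 \<Longrightarrow> (j, k) \<noteq> (0, 0) \<Longrightarrow>
       cmod (u + cnj u * omega ^ j + of_real (2 * s) * omega ^ k) \<le> sqrt 3"
    using hexagon_points[OF s] by blast
  have ph: "\<exists>U. cmod U = 1 \<and> D * U = of_real (cmod D)" for D
  proof (cases "D = 0")
    case False
    then show ?thesis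
      by (intro exI[of _ "cnj D / of_real (cmod D)"])
         (simp add: norm_divide complex_norm_square[symmetric] power2_eq_square)
  qed (auto intro: exI[of _ 1])
  obtain U V W where U: "cmod U = 1" "A * U = of_real (cmod A)" and V: "cmod V = 1" "B * V = of_real (cmod B)"
    and W: "cmod W = 1" "C * W = of_real (cmod C)" using ph by metis
  have s': "cmod C = \<beta> * (2 * s)" using b0 by (simp add: s_def)
  show ?thesis
  proof (rule that[of "U * u" "V * cnj u" W])
    fix j k :: nat assume jk: "j < 3" "k < 3" "(j, k) \<noteq> (0, 0)"
    have "A * (U * u) + B * (V * cnj u) * omega ^ j + C * W * omega ^ k
      = of_real (cmod A - \<beta>) * u + of_real \<beta> * (u + cnj u * omega ^ j + of_real (2 * s) * omega ^ k)"
      unfolding mult.assoc[symmetric] U V W s' by (simp add: \<beta>_def algebra_simps)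
    also have "cmod \<dots> \<le> (cmod A - \<beta>) * 1 + \<beta> * sqrt 3"
      using hex[OF jk] assms b0 u
      by (intro order_trans[OF norm_triangle_ineq] add_mono)
         (simp_all add: norm_mult \<beta>_def del: of_real_diff of_real_mult)
    also have "\<dots> \<le> (cmod A - \<beta>) * sqrt 3 + \<beta> * sqrt 3"
      using assms by (intro add_right_mono mult_left_mono) (simp_all add: \<beta>_def)
    also have "\<dots> = cmod A * sqrt 3" by (simp add: algebra_simps)
    also have "\<dots> \<le> sqrt 3" using assms by simp
    finally show "\<not> exceeds (A * (U * u)) (B * (V * cnj u)) (C * W) j k" by (simp add: exceeds_def)
  qed (simp_all add: U V W u norm_mult)
qed

lemma three_rows_sorted:
  fixes A B C :: "nat \<Rightarrow> complex"
  assumes "\<And>i. cmod (A i) \<le> 1" "\<And>i. cmod (B i) \<le> 1" "\<And>i. cmod (C i) \<le> 1"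
    and "cmod (B 0) \<le> cmod (A 0)" "cmod (C 0) \<le> cmod (B 0)"
  obtains X Y Z where "cmod X = 1" "cmod Y = 1" "cmod Z = 1"
    "\<And>i. i < 3 \<Longrightarrow> cmod (A i * X + B i * Y + C i * Z) \<le> sqrt 3"
proof -
  obtain X Y Z where n: "cmod X = 1" "cmod Y = 1" "cmod Z = 1"
    and row0: "\<And>j k. j < 3 \<Longrightarrow> k < 3 \<Longrightarrow> (j, k) \<noteq> (0, 0) \<Longrightarrow> \<not> exceeds (A 0 * X) (B 0 * Y) (C 0 * Z) j k"
    using row_exceeds_at_most_once[OF assms(1,4,5)] by blast
  define e where "e i = exceeds (A i * X) (B i * Y) (C i * Z)" for i
  have sp: "sparse (e i)" for i
    unfolding e_def using assms n by (intro sparse_exceeds) (simp_all add: norm_mult)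
  have per: "e i 3 k = e i 0 k" "e i 4 k = e i 1 k" "e i j 3 = e i j 0" "e i j 4 = e i j 1" for i j k
    unfolding e_def by (rule exceeds_period)+
  have "\<exists>j<3. \<exists>k<3. (j, k) \<noteq> (0, 0) \<and> \<not> e 1 j k \<and> \<not> e 2 j k"
    using two_sparse_not_cover[OF sp[of 1] sp[of 2] per per]
    by (metis (no_types, opaque_lifting) Pair_inject numeral_2_eq_2 numeral_3_eq_3 lessI less_SucI zero_less_Suc One_nat_def old.nat.distinct(1))
  then obtain j k where jk: "j < 3" "k < 3" "(j, k) \<noteq> (0, 0)" "\<not> e 1 j k" "\<not> e 2 j k" by blast
  show ?thesis
  proof (rule that[of X "Y * omega ^ j" "Z * omega ^ k"])
    fix i :: nat assume "i < 3"
    then have "i = 0 \<or> i = 1 \<or> i = 2" by auto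
    then have "\<not> e i j k" using row0[OF jk(1-3)] jk(4,5) by (auto simp: e_def)
    then show "cmod (A i * X + B i * (Y * omega ^ j) + C i * (Z * omega ^ k)) \<le> sqrt 3"
      by (simp add: e_def exceeds_def mult.assoc)
  qed (simp_all add: n norm_mult norm_power cmod_omega)
qed

section \<open>Choice of a unimodular coefficient, and part (i)\<close>

text \<open>Making \<open>t * a\<close> purely imaginary leaves the sign of \<open>t\<close> free,
  and that sign settles the condition on \<open>b\<close>. In the applications \<open>a\<close> and
  \<open>b\<close> are the cross terms of two squared moduli.\<close>

lemma unimodular_halfplane:
  fixes a b :: complex
  obtains t where "cmod t = 1" "Re (t * a) \<le> 0" "Re (t * b) \<le> 0"
proof -
  have ex: "\<exists>t. cmod t = 1 \<and> Re (t * a) = 0 \<and> Re (t * b) \<le> 0" for a b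
  proof -
    define s where "s = (if a = 0 then 1 else \<i> * cnj a / of_real (cmod a))"
    have s: "cmod s = 1" "Re (s * a) = 0"
      by (auto simp: s_def norm_divide norm_mult algebra_simps)
    show ?thesis
    proof (cases "Re (s * b) \<le> 0")
      case True
      then show ?thesis using s by blast
    next
      case False
      then show ?thesis using s by (intro exI[of _ "- s"]) auto
    qed
  qed
  then obtain t where "cmod t = 1 \<and> Re (t * a) = 0 \<and> Re (t * b) \<le> 0" by blast
  then show ?thesis using that[of t] by simp
qed

lemma cmod_add_sq: "(cmod (x + y))\<^sup>2 = (cmod x)\<^sup>2 + (cmod y)\<^sup>2 + 2 * Re (x * cnj y)"
  unfolding cmod_power2 by (simp add: power2_eq_square algebra_simps)

lemma unimodular_two_rows:
  fixes a b c d :: complex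
  obtains t where "cmod t = 1"
    "(cmod (a + b * t))\<^sup>2 \<le> (cmod a)\<^sup>2 + (cmod b)\<^sup>2" "(cmod (c + d * t))\<^sup>2 \<le> (cmod c)\<^sup>2 + (cmod d)\<^sup>2"
proof -
  obtain t where t: "cmod t = 1" "Re (t * (cnj a * b)) \<le> 0" "Re (t * (cnj c * d)) \<le> 0"
    by (rule unimodular_halfplane)
  have "Re (x * cnj (y * t)) = Re (t * (cnj x * y))" for x y
    by (simp add: algebra_simps)
  then show ?thesis using that[of t] t by (simp add: cmod_add_sq norm_mult)
qed

lemma UNIV_2_obtain:
  assumes "CARD('n::finite) = 2"
  obtains i j :: "'n::finite" where "i \<noteq> j" "UNIV = {i, j}"
  using assms card_2_iff[of "UNIV :: 'n set"] by blast

lemma UNIV_3_sorted: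
  fixes f :: "'n::finite \<Rightarrow> real"
  assumes "CARD('n) = 3"
  obtains i j k :: "'n::finite" where "i \<noteq> j" "i \<noteq> k" "j \<noteq> k" "UNIV = {i, j, k}" "f j \<le> f i" "f k \<le> f j"
proof -
  obtain ys where ys: "set ys = (UNIV :: 'n set)" "distinct ys"
    using finite_distinct_list[OF finite[of "UNIV :: 'n set"]] by blast
  define xs where "xs = rev (sort_key f ys)"
  have xs: "distinct xs" "set xs = UNIV" "sorted (map f (rev xs))"
    using ys by (simp_all add: xs_def)
  then have "length xs = 3" using assms distinct_card by fastforce
  then obtain i j k where x: "xs = [i, j, k]"
    by (metis (no_types, opaque_lifting) length_0_conv length_Suc_conv numeral_3_eq_3)
  show ?thesis using that[of i j k] xs by (simp add: x)
qed

lemma unimodular_small_products: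
  fixes a :: "'n::finite \<Rightarrow> complex ^ 'n"
  assumes n: "CARD('n) \<in> {2, 3}" and a: "\<And>i j. cmod (a i $ j) \<le> 1"
  shows "\<exists>x. unimodular x \<and> (\<forall>i. cmod (cinner x (a i)) \<le> sqrt CARD('n))"
proof (cases "CARD('n) = 2")
  case True
  obtain p q :: 'n where pq: "p \<noteq> q" "UNIV = {p, q}" using UNIV_2_obtain[OF True] by blast
  obtain t where t: "cmod t = 1" "(cmod (cnj (a p $ p) + cnj (a p $ q) * t))\<^sup>2 \<le> (cmod (cnj (a p $ p)))\<^sup>2 + (cmod (cnj (a p $ q)))\<^sup>2"
    "(cmod (cnj (a q $ p) + cnj (a q $ q) * t))\<^sup>2 \<le> (cmod (cnj (a q $ p)))\<^sup>2 + (cmod (cnj (a q $ q)))\<^sup>2"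
    by (rule unimodular_two_rows)
  define x :: "complex ^ 'n" where "x = (\<chi> i. if i = p then 1 else t)"
  have "cmod (cinner x (a i)) \<le> sqrt 2" for i
  proof (rule real_le_rsqrt)
    have "cinner x (a i) = cnj (a i $ p) + cnj (a i $ q) * t"
      using pq(1) by (simp add: cinner_def pq(2) x_def mult.commute)
    moreover have "i = p \<or> i = q" using pq(2) by blast
    moreover have "(cmod (a i $ j))\<^sup>2 \<le> 1" for j using a by (simp add: power_le_one)
    ultimately show "(cmod (cinner x (a i)))\<^sup>2 \<le> 2"
      using t(2,3) by (smt (verit) complex_mod_cnj)
  qed
  then show ?thesis using t(1) by (intro exI[of _ x]) (auto simp: unimodular_def x_def True)
next
  case False
  then have n3: "CARD('n) = 3" using n by simp
  obtain r0 r1 r2 :: 'n where r: "UNIV = {r0, r1, r2}" using UNIV_3_sorted[OF n3, of "\<lambda>_. 0"] by metis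
  \<comment> \<open>The columns are ordered by the moduli in row \<open>r0\<close>, the row for
    which the base point will be chosen.\<close>
  obtain p q s :: 'n where d: "p \<noteq> q" "p \<noteq> s" "q \<noteq> s" and u: "UNIV = {p, q, s}"
    and le: "cmod (a r0 $ q) \<le> cmod (a r0 $ p)" "cmod (a r0 $ s) \<le> cmod (a r0 $ q)"
    by (rule UNIV_3_sorted[OF n3, of "\<lambda>j. cmod (a r0 $ j)"])
  define row where "row i = (if i = 0 then r0 else if i = 1 then r1 else r2)" for i :: nat
  obtain X Y Z where m: "cmod X = 1" "cmod Y = 1" "cmod Z = 1"
    and *: "\<And>i. i < 3 \<Longrightarrow> cmod (cnj (a (row i) $ p) * X + cnj (a (row i) $ q) * Y + cnj (a (row i) $ s) * Z) \<le> sqrt 3"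
    by (rule three_rows_sorted[of "\<lambda>i. cnj (a (row i) $ p)" "\<lambda>i. cnj (a (row i) $ q)" "\<lambda>i. cnj (a (row i) $ s)"])
       (use a le in \<open>simp_all add: row_def\<close>)
  define x :: "complex ^ 'n" where "x = (\<chi> i. if i = p then X else if i = q then Y else Z)"
  have c: "cinner x v = cnj (v $ p) * X + cnj (v $ q) * Y + cnj (v $ s) * Z" for v
    using d by (simp add: cinner_def u x_def algebra_simps)
  have "cmod (cinner x (a i)) \<le> sqrt 3" for i
  proof -
    have "i = row 0 \<or> i = row 1 \<or> i = row 2" using r by (auto simp: row_def)
    then show ?thesis unfolding c using *[of 0] *[of 1] *[of 2] by auto
  qed
  then show ?thesis using m by (intro exI[of _ x]) (auto simp: unimodular_def x_def n3)
qed

section \<open>Operator norms\<close>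

text \<open>Being homogeneous and squeezed between the maximum norm and the l1 norm is what makes
  \<open>op_norm\<close> a bounded supremum and permits rescaling. Minkowski's inequality is thereby
  avoided.\<close>

definition coord_norm :: "(complex ^ 'n \<Rightarrow> real) \<Rightarrow> bool" where
  "coord_norm N \<longleftrightarrow> (\<forall>x i. cmod (x $ i) \<le> N x) \<and> (\<forall>x. N x \<le> (\<Sum>i\<in>UNIV. cmod (x $ i)))
     \<and> (\<forall>c x. N (c *s x) = cmod c * N x)"

lemma lp_norm_infinity: "lp_norm \<infinity> x = Max (range (\<lambda>i. cmod (x $ i)))"
  by (simp add: lp_norm_def)

lemma lp_norm_ereal:
  "lp_norm (ereal r) x = (\<Sum>i\<in>UNIV. cmod (x $ i) powr r) powr (1 / r)"
  by (simp add: lp_norm_def)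

lemma lp_norm_one: "lp_norm 1 x = (\<Sum>i\<in>UNIV. cmod (x $ i))"
  using lp_norm_ereal[of 1 x] by (simp add: one_ereal_def powr_one sum_nonneg)

lemma ereal_ge_one_cases:
  fixes p :: ereal
  assumes "1 \<le> p"
  obtains "p = \<infinity>" | r where "p = ereal r" "1 \<le> r"
  using assms by (cases p) auto

lemma coord_norm_lp_norm:
  assumes p: "1 \<le> p"
  shows "coord_norm (lp_norm p :: complex ^ 'n \<Rightarrow> real)"
  using p
proof (cases rule: ereal_ge_one_cases)
  case 1
  have "Max (range (\<lambda>i. cmod (x $ i))) \<le> (\<Sum>i\<in>UNIV. cmod (x $ i))" for x :: "complex ^ 'n"
    by (intro Max.boundedI) (auto intro: member_le_sum)
  moreover have "Max (range (\<lambda>i. cmod (c * x $ i))) = cmod c * Max (range (\<lambda>i. cmod (x $ i)))"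
    for c and x :: "complex ^ 'n"
    using mono_Max_commute[of "\<lambda>t. cmod c * t" "range (\<lambda>i. cmod (x $ i))"]
    by (simp add: mono_def mult_left_mono image_image norm_mult)
  ultimately show ?thesis by (simp add: coord_norm_def 1 lp_norm_infinity)
next
  case (2 r)
  let ?S = "\<lambda>x :: complex ^ 'n. \<Sum>i\<in>UNIV. cmod (x $ i) powr r"
  have S0: "?S x \<ge> 0" for x by (intro sum_nonneg) auto
  have "cmod (x $ i) \<le> ?S x powr (1 / r)" for x i
  proof -
    have "cmod (x $ i) = (cmod (x $ i) powr r) powr (1 / r)" using 2 by (simp add: powr_powr)
    also have "\<dots> \<le> ?S x powr (1 / r)"
      using 2 by (intro powr_mono2 member_le_sum) auto
    finally show ?thesis .
  qed
  moreover have "?S x powr (1 / r) \<le> (\<Sum>i\<in>UNIV. cmod (x $ i))" for x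
  proof -
    let ?T = "\<Sum>i\<in>UNIV. cmod (x $ i)"
    have T0: "?T \<ge> 0" by (intro sum_nonneg) auto
    have le: "cmod (x $ i) \<le> ?T" for i by (intro member_le_sum) auto
    have "cmod (x $ i) powr r \<le> cmod (x $ i) * ?T powr (r - 1)" for i
    proof (cases "x $ i = 0")
      case False
      then have "cmod (x $ i) powr r = cmod (x $ i) * cmod (x $ i) powr (r - 1)"
        by (simp add: powr_diff)
      also have "\<dots> \<le> cmod (x $ i) * ?T powr (r - 1)"
        using 2 le by (intro mult_left_mono powr_mono2) auto
      finally show ?thesis .
    qed auto
    then have "?S x \<le> (\<Sum>i\<in>UNIV. cmod (x $ i) * ?T powr (r - 1))" by (intro sum_mono)
    also have "\<dots> = ?T * ?T powr (r - 1)" by (simp add: sum_distrib_right)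
    also have "\<dots> = ?T powr r" using T0 by (cases "?T = 0") (simp_all add: powr_diff)
    finally have "?S x powr (1 / r) \<le> (?T powr r) powr (1 / r)" using 2 S0 by (intro powr_mono2) auto
    also have "\<dots> = ?T" using 2 T0 by (simp add: powr_powr)
    finally show ?thesis .
  qed
  moreover have "?S (c *s x) powr (1 / r) = cmod c * ?S x powr (1 / r)" for c x
  proof -
    have "?S (c *s x) = cmod c powr r * ?S x"
      by (simp add: norm_mult powr_mult sum_distrib_left)
    then show ?thesis using 2 S0 by (simp add: powr_mult powr_powr)
  qed
  ultimately show ?thesis by (simp add: coord_norm_def 2 lp_norm_ereal)
qed

lemma
  assumes "coord_norm N"
  shows coord_norm_component_le: "cmod (x $ i) \<le> N x"
    and coord_norm_le_sum: "N x \<le> (\<Sum>i\<in>UNIV. cmod (x $ i))"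
    and coord_norm_scale: "N (c *s x) = cmod c * N x"
    and coord_norm_zero: "N 0 = 0"
    and coord_norm_nonneg: "0 \<le> N x"
    and coord_norm_eq_0: "N x = 0 \<Longrightarrow> x = 0"
proof -
  show le: "cmod (x $ i) \<le> N x" for x i using assms by (simp add: coord_norm_def)
  show "N x \<le> (\<Sum>i\<in>UNIV. cmod (x $ i))" for x using assms by (simp add: coord_norm_def)
  show sc: "N (c *s x) = cmod c * N x" for c x using assms by (simp add: coord_norm_def)
  show "N 0 = 0" using sc[of 0 0] by simp
  show "0 \<le> N x" using le[of x] norm_ge_zero order_trans by blast
  show "x = 0" if "N x = 0" using le[of x] that by (simp add: vec_eq_iff)
qed

lemma linear_component:
  fixes A :: "complex ^ 'n \<Rightarrow> complex ^ 'm"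
  assumes "Vector_Spaces.linear (*s) (*s) A"
  shows "A x $ i = (\<Sum>j\<in>UNIV. A (axis j 1) $ i * x $ j)"
proof -
  have "A x = matrix A *v x" using matrix_works[OF assms] by simp
  then show ?thesis by (simp add: matrix_vector_mult_def matrix_def)
qed

lemma bdd_above_op_norm:
  fixes A :: "complex ^ 'n \<Rightarrow> complex ^ 'm"
  assumes N: "coord_norm N" and M: "coord_norm M" and A: "Vector_Spaces.linear (*s) (*s) A"
  shows "bdd_above {M (A x) | x. N x \<le> 1}"
proof -
  have "M (A x) \<le> (\<Sum>i\<in>UNIV. \<Sum>j\<in>UNIV. cmod (A (axis j 1) $ i))" if "N x \<le> 1" for x
  proof -
    have "M (A x) \<le> (\<Sum>i\<in>UNIV. cmod (A x $ i))" by (rule coord_norm_le_sum[OF M])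
    also have "\<dots> \<le> (\<Sum>i\<in>UNIV. \<Sum>j\<in>UNIV. cmod (A (axis j 1) $ i))"
    proof (intro sum_mono)
      fix i
      have "cmod (A x $ i) \<le> (\<Sum>j\<in>UNIV. cmod (A (axis j 1) $ i * x $ j))"
        unfolding linear_component[OF A, of x] by (rule norm_sum)
      also have "\<dots> \<le> (\<Sum>j\<in>UNIV. cmod (A (axis j 1) $ i))"
        using order_trans[OF coord_norm_component_le[OF N] that]
        by (intro sum_mono) (simp add: norm_mult mult_left_le)
      finally show "cmod (A x $ i) \<le> (\<Sum>j\<in>UNIV. cmod (A (axis j 1) $ i))" .
    qed
    finally show ?thesis .
  qed
  then show ?thesis by (auto intro!: bdd_aboveI)
qed

lemma op_norm_bound:
  fixes A :: "complex ^ 'n \<Rightarrow> complex ^ 'm"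
  assumes N: "coord_norm N" and M: "coord_norm M" and A: "Vector_Spaces.linear (*s) (*s) A"
  shows "M (A x) \<le> op_norm N M A * N x"
proof (cases "N x = 0")
  case True
  interpret Vector_Spaces.linear "(*s)" "(*s)" A by (rule A)
  have "A x = 0" using coord_norm_eq_0[OF N True] zero by simp
  then show ?thesis using True coord_norm_zero[OF M] by simp
next
  case False
  interpret Vector_Spaces.linear "(*s)" "(*s)" A by (rule A)
  have N0: "N x > 0" using False coord_norm_nonneg[OF N, of x] by simp
  define y where "y = complex_of_real (1 / N x) *s x"
  have "N y = 1" using N0 by (simp add: y_def coord_norm_scale[OF N] norm_divide)
  then have "M (A y) \<le> op_norm N M A"
    unfolding op_norm_def by (intro cSup_upper bdd_above_op_norm[OF N M A]) auto
  moreover have "M (A y) = M (A x) / N x"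
    using N0 by (simp add: y_def scale coord_norm_scale[OF M] norm_divide)
  ultimately show ?thesis using N0 by (simp add: field_simps)
qed

lemma op_norm_le:
  assumes N: "coord_norm N" and "0 \<le> c" and "\<And>x. M (A x) \<le> c * N x"
  shows "op_norm N M A \<le> c"
  unfolding op_norm_def
proof (rule cSup_least)
  show "{M (A x) |x. N x \<le> 1} \<noteq> {}" using coord_norm_zero[OF N] by (auto intro!: exI[of _ 0])
next
  fix y assume "y \<in> {M (A x) |x. N x \<le> 1}"
  then obtain x where x: "y = M (A x)" "N x \<le> 1" by blast
  have "c * N x \<le> c * 1" using x(2) assms(2) by (intro mult_left_mono) auto
  then show "y \<le> c" using assms(3)[of x] x(1) by simp
qed

lemma op_norm_nonneg:
  fixes A :: "complex ^ 'n \<Rightarrow> complex ^ 'm"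
  assumes N: "coord_norm N" and M: "coord_norm M" and A: "Vector_Spaces.linear (*s) (*s) A"
  shows "0 \<le> op_norm N M A"
proof -
  fix j :: 'n
  define x :: "complex ^ 'n" where "x = axis j 1"
  have "0 \<le> M (A x)" by (rule coord_norm_nonneg[OF M])
  also have "\<dots> \<le> op_norm N M A * N x" by (rule op_norm_bound[OF assms])
  finally have "0 \<le> op_norm N M A * N x" .
  moreover have "N x \<ge> 1" using coord_norm_component_le[OF N, of x j] by (simp add: x_def axis_def)
  ultimately show ?thesis by (simp add: zero_le_mult_iff)
qed

text \<open>Both distances are attained, so the infimum is treated as a minimum: an explicit pair of
  inverse matrices gives a product of operator norms of at most \<open>c * d\<close>, and the
  general lower bound forces it to equal \<open>b\<close>.\<close>

lemma banach_mazur_eqI: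
  fixes N :: "complex ^ 'n \<Rightarrow> real" and M :: "complex ^ 'n \<Rightarrow> real"
  assumes N: "coord_norm N" and M: "coord_norm M"
    and HK: "H ** K = mat 1" "K ** H = mat 1"
    and H: "0 \<le> c" "\<And>x. M (H *v x) \<le> c * N x" and K: "0 \<le> d" "\<And>x. N (K *v x) \<le> d * M x"
    and cd: "c * d \<le> b"
    and lower: "\<And>A. Vector_Spaces.linear (*s) (*s) A \<Longrightarrow> bij A \<Longrightarrow> b \<le> op_norm N M A * op_norm M N (inv A)"
  shows "banach_mazur N M = b"
proof -
  have lin: "Vector_Spaces.linear (*s) (*s) ((*v) H)" for H :: "complex ^ 'n ^ 'n"
    by (rule matrix_vector_mul_linear_gen)
  have id: "H *v (K *v x) = x" "K *v (H *v x) = x" for x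
    using HK by (simp_all add: matrix_vector_mul_assoc)
  have bij: "bij ((*v) H)" by (rule bij_betw_byWitness[of _ "(*v) K"]) (auto simp: id)
  have inv: "inv ((*v) H) = (*v) K" by (rule inv_unique_comp) (auto simp: id)
  have "op_norm N M ((*v) H) * op_norm M N ((*v) K) \<le> c * d"
    using op_norm_le[where A = "(*v) H", OF N H] op_norm_le[where A = "(*v) K", OF M K] op_norm_nonneg[OF M N lin] H(1)
    by (intro mult_mono) auto
  then have "op_norm N M ((*v) H) * op_norm M N (inv ((*v) H)) = b"
    using lower[OF lin bij] cd unfolding inv by linarith
  then show ?thesis
    unfolding banach_mazur_def
    by (intro cInf_eq_minimum) (use lin bij lower in auto)
qed

lemma linear_inv:
  fixes A :: "complex ^ 'n \<Rightarrow> complex ^ 'n"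
  assumes "Vector_Spaces.linear (*s) (*s) A" "bij A"
  shows "Vector_Spaces.linear (*s) (*s) (inv A)"
  by (rule vec.inj_linear_imp_inv_linear) (use assms in \<open>auto simp: bij_is_inj\<close>)

lemma inv_bij: "bij A \<Longrightarrow> inv A (A x) = x" "bij A \<Longrightarrow> A (inv A x) = x"
  by (simp_all add: bij_is_inj bij_is_surj surj_f_inv_f)

lemma op_norm_pos:
  fixes A :: "complex ^ 'n \<Rightarrow> complex ^ 'n"
  assumes N: "coord_norm N" and M: "coord_norm M" and A: "Vector_Spaces.linear (*s) (*s) A" "bij A"
  shows "0 < op_norm N M A"
proof (rule ccontr)
  assume "\<not> 0 < op_norm N M A"
  then have z: "op_norm N M A = 0" using op_norm_nonneg[OF N M A(1)] by simp
  have "A x = 0" for x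
    using op_norm_bound[OF N M A(1), of x] coord_norm_nonneg[OF M, of "A x"] z
    by (intro coord_norm_eq_0[OF M]) simp
  then have "inv A (A x) = inv A (A 0)" for x by simp
  then have "(axis undefined 1 :: complex ^ 'n) = 0" unfolding inv_bij(1)[OF A(2)] .
  then show False by (simp add: axis_eq_0_iff)
qed

section \<open>Part (ii): the distance between l1 and l-infinity\<close>

text \<open>The l1 to l-infinity norm \<open>\<alpha>\<close> dominates every matrix entry, so the
  rows divided by \<open>\<alpha>\<close> satisfy the hypothesis of (i). The unimodular
  \<open>x\<close> obtained has l1 norm n, while the maximum norm of \<open>A x\<close> is at most
  sqrt n times \<open>\<alpha>\<close>; the inverse must make up for the ratio.\<close>

lemma op_norm_product_lower_bound:
  fixes A :: "complex ^ 'n::finite \<Rightarrow> complex ^ 'n"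
  assumes n: "CARD('n) \<in> {2, 3}" and A: "Vector_Spaces.linear (*s) (*s) A" "bij A"
  shows "sqrt CARD('n) \<le> op_norm (lp_norm 1) (lp_norm \<infinity>) A * op_norm (lp_norm \<infinity>) (lp_norm 1) (inv A)"
proof -
  have N: "coord_norm (lp_norm 1 :: complex ^ 'n \<Rightarrow> real)" and M: "coord_norm (lp_norm \<infinity> :: complex ^ 'n \<Rightarrow> real)"
    by (simp_all add: coord_norm_lp_norm)
  define \<alpha> where "\<alpha> = op_norm (lp_norm 1) (lp_norm \<infinity>) A"
  define \<beta> where "\<beta> = op_norm (lp_norm \<infinity>) (lp_norm 1) (inv A)"
  have \<alpha>: "\<alpha> > 0" unfolding \<alpha>_def by (rule op_norm_pos[OF N M A])
  have entry: "cmod (A (axis j 1) $ i) \<le> \<alpha>" for i j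
  proof -
    have "lp_norm 1 (axis j 1 :: complex ^ 'n) = (\<Sum>k\<in>UNIV. if k = j then 1 else 0)"
      unfolding lp_norm_one by (intro sum.cong) (auto simp: axis_def)
    then have "lp_norm \<infinity> (A (axis j 1)) \<le> \<alpha>"
      using op_norm_bound[OF N M A(1), of "axis j 1"] by (simp add: \<alpha>_def)
    then show ?thesis using coord_norm_component_le[OF M] order_trans by blast
  qed
  define a :: "'n \<Rightarrow> complex ^ 'n" where "a i = (\<chi> j. cnj (A (axis j 1) $ i) / of_real \<alpha>)" for i
  have "cmod (a i $ j) \<le> 1" for i j using entry[of j i] \<alpha> by (simp add: a_def norm_divide)
  then obtain x where x: "unimodular x" "\<And>i. cmod (cinner x (a i)) \<le> sqrt CARD('n)"
    using unimodular_small_products[OF n, of a] by blast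
  have "cinner x (a i) = A x $ i / of_real \<alpha>" for i
    by (simp add: cinner_def a_def linear_component[OF A(1), of x] sum_divide_distrib mult.commute)
  then have "cmod (A x $ i) \<le> sqrt CARD('n) * \<alpha>" for i
    using x(2)[of i] \<alpha> by (simp add: norm_divide pos_divide_le_eq)
  then have "lp_norm \<infinity> (A x) \<le> sqrt CARD('n) * \<alpha>"
    unfolding lp_norm_infinity by (intro Max.boundedI) auto
  moreover have "lp_norm 1 x \<le> \<beta> * lp_norm \<infinity> (A x)"
    using op_norm_bound[OF M N linear_inv[OF A], of "A x"] by (simp add: inv_bij A(2) \<beta>_def)
  moreover have "\<beta> \<ge> 0" unfolding \<beta>_def by (rule op_norm_nonneg[OF M N linear_inv[OF A]])
  ultimately have "lp_norm 1 x \<le> \<beta> * (sqrt CARD('n) * \<alpha>)" by (meson mult_left_mono order_trans)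
  moreover have "lp_norm 1 x = sqrt CARD('n) * sqrt CARD('n)"
    using x(1) by (simp add: lp_norm_one unimodular_def)
  ultimately have "sqrt CARD('n) * sqrt CARD('n) \<le> (\<alpha> * \<beta>) * sqrt CARD('n)"
    by (simp only: mult_ac)
  then show ?thesis unfolding \<alpha>_def \<beta>_def by (rule mult_right_le_imp_le) simp
qed

text \<open>\<open>f\<close> numbers the abstract index type by 0, ..., n - 1. The entries of the
  product are sums of powers of an n-th root of unity \<open>z\<close>, which vanish by the
  geometric sum formula unless z = 1.\<close>

lemma fourier_matrix_orthogonal:
  fixes f :: "'n::finite \<Rightarrow> nat"
  assumes f: "bij_betw f UNIV {..<CARD('n)}"
  defines "F \<equiv> (\<chi> i j. cis (2 * pi * real (f i) * real (f j) / CARD('n))) :: complex ^ 'n ^ 'n"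
    and "G \<equiv> (\<chi> i j. cis (- (2 * pi * real (f i) * real (f j) / CARD('n))) / CARD('n)) :: complex ^ 'n ^ 'n"
  shows "F ** G = mat 1" "G ** F = mat 1"
proof -
  let ?n = "CARD('n)"
  have n0: "?n > 0" by simp
  have s: "(\<Sum>k\<in>UNIV. cis (2 * pi * (real (f i) - real (f j)) * real (f k) / ?n)) = (if i = j then of_nat ?n else 0)" for i j
  proof (cases "i = j")
    case False
    define z where "z = cis (2 * pi * (real (f i) - real (f j)) / ?n)"
    have lt: "f i < ?n" for i using f by (auto simp: bij_betw_def)
    have "f i \<noteq> f j" using f False by (auto simp: bij_betw_def inj_on_def)
    have zn: "z ^ ?n = 1"
    proof -
      have "z ^ ?n = cis (2 * pi * of_int (int (f i) - int (f j)))"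
        using n0 by (simp add: z_def Complex.DeMoivre)
      then show ?thesis by (simp only: cis_multiple_2pi[OF Ints_of_int])
    qed
    \<comment> \<open>If z = 1 then n divides \<open>f i - f j\<close>, a nonzero integer of
      absolute value below n.\<close>
    have z1: "z \<noteq> 1"
    proof
      assume "z = 1"
      then have "cos (2 * pi * (real (f i) - real (f j)) / ?n) = 1" by (simp add: z_def complex_eq_iff)
      then obtain m :: int where "2 * pi * (real (f i) - real (f j)) / ?n = of_int m * 2 * pi"
        unfolding cos_one_2pi_int by blast
      then have "2 * pi * ((real (f i) - real (f j)) / ?n) = 2 * pi * of_int m" by (simp add: mult_ac)
      then have "(real (f i) - real (f j)) / ?n = of_int m" by (subst (asm) mult_left_cancel) auto
      then have "real (f i) - real (f j) = of_int m * real ?n" using n0 by (simp add: field_simps)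
      then have eq: "int (f i) - int (f j) = m * int ?n"
      proof -
        have "real_of_int (int (f i) - int (f j)) = real_of_int (m * int ?n)"
          using \<open>real (f i) - real (f j) = of_int m * real ?n\<close> by simp
        then show ?thesis by (simp only: of_int_eq_iff)
      qed
      moreover have "\<bar>int (f i) - int (f j)\<bar> < int ?n" using lt[of i] lt[of j] by linarith
      ultimately have "m = 0" by (auto simp: abs_mult)
      then show False using eq \<open>f i \<noteq> f j\<close> by simp
    qed
    have "(\<Sum>k\<in>UNIV. cis (2 * pi * (real (f i) - real (f j)) * real (f k) / ?n)) = (\<Sum>k\<in>UNIV. z ^ f k)"
      by (intro sum.cong) (simp_all add: z_def Complex.DeMoivre mult_ac)
    also have "\<dots> = (\<Sum>m<?n. z ^ m)" by (rule sum.reindex_bij_betw[OF f])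
    also have "\<dots> = 0" using z1 zn by (simp add: geometric_sum)
    finally show ?thesis using False by simp
  qed simp
  have "(F ** G) $ i $ j = (if i = j then 1 else 0)" for i j
  proof -
    have "(F ** G) $ i $ j = (\<Sum>k\<in>UNIV. cis (2 * pi * (real (f i) - real (f j)) * real (f k) / ?n)) / ?n"
      unfolding matrix_matrix_mult_def F_def G_def sum_divide_distrib
      by (auto intro!: sum.cong simp: cis_mult diff_divide_distrib algebra_simps)
    then show ?thesis unfolding s by simp
  qed
  then show FG: "F ** G = mat 1" by (simp add: vec_eq_iff mat_def)
  show "G ** F = mat 1" using FG by (simp add: matrix_left_right_inverse)
qed

lemma banach_mazur_l1_linf:
  assumes n: "CARD('n::finite) \<in> {2, 3}"
  shows "banach_mazur (lp_norm 1 :: complex ^ 'n \<Rightarrow> real) (lp_norm \<infinity> :: complex ^ 'n \<Rightarrow> real) = sqrt CARD('n)"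
proof -
  let ?n = "CARD('n)"
  have N: "coord_norm (lp_norm 1 :: complex ^ 'n \<Rightarrow> real)" and M: "coord_norm (lp_norm \<infinity> :: complex ^ 'n \<Rightarrow> real)"
    by (simp_all add: coord_norm_lp_norm)
  obtain f :: "'n \<Rightarrow> nat" where f: "bij_betw f UNIV {..<?n}"
    using ex_bij_betw_finite_nat[of "UNIV :: 'n set"] by (auto simp: atLeast0LessThan)
  define F :: "complex ^ 'n ^ 'n" where "F = (\<chi> i j. cis (2 * pi * real (f i) * real (f j) / ?n))"
  define G :: "complex ^ 'n ^ 'n" where "G = (\<chi> i j. cis (- (2 * pi * real (f i) * real (f j) / ?n)) / ?n)"
  have FG: "F ** G = mat 1" "G ** F = mat 1"
    unfolding F_def G_def by (rule fourier_matrix_orthogonal[OF f])+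
  have "lp_norm \<infinity> (F *v x) \<le> 1 * lp_norm 1 x" for x
  proof -
    have "cmod ((F *v x) $ i) \<le> (\<Sum>j\<in>UNIV. cmod (F $ i $ j * x $ j))" for i
      unfolding matrix_vector_mult_def by (simp add: norm_sum)
    then show ?thesis
      unfolding lp_norm_infinity lp_norm_one by (intro Max.boundedI) (auto simp: F_def norm_mult)
  qed
  \<comment> \<open>\<open>F\<close> is sqrt n times a unitary matrix. Hence |z|_2^2 = |y|_2^2 / n,
    which is at most the squared maximum norm of \<open>y\<close>, and Cauchy-Schwarz passes from
    |z|_2 to the l1 norm at the cost of sqrt n.\<close>
  moreover have "lp_norm 1 (G *v y) \<le> sqrt ?n * lp_norm \<infinity> y" for y
  proof -
    define z where "z = G *v y"
    have Fz: "F *v z = y" by (simp add: z_def matrix_vector_mul_assoc FG)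
    have z: "z $ i = (\<Sum>k\<in>UNIV. cnj (F $ k $ i) / ?n * y $ k)" for i
      unfolding z_def matrix_vector_mult_def by (simp add: F_def G_def cis_cnj mult_ac)
    have "complex_of_real (\<Sum>i\<in>UNIV. (cmod (z $ i))\<^sup>2) = (\<Sum>i\<in>UNIV. z $ i * cnj (z $ i))"
      by (simp only: of_real_sum complex_norm_square)
    also have "\<dots> = (\<Sum>i\<in>UNIV. \<Sum>k\<in>UNIV. z $ i * (F $ k $ i / ?n * cnj (y $ k)))"
      by (subst (2) z) (simp add: sum_distrib_left)
    also have "\<dots> = (\<Sum>k\<in>UNIV. \<Sum>i\<in>UNIV. z $ i * (F $ k $ i / ?n * cnj (y $ k)))" by (rule sum.swap)
    also have "\<dots> = (\<Sum>k\<in>UNIV. (F *v z) $ k * cnj (y $ k) / ?n)"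
      unfolding matrix_vector_mult_def
      by (intro sum.cong) (auto simp: sum_distrib_left sum_distrib_right sum_divide_distrib mult_ac)
    also have "\<dots> = complex_of_real ((\<Sum>k\<in>UNIV. (cmod (y $ k))\<^sup>2) / ?n)"
      unfolding Fz by (simp add: complex_norm_square[symmetric] sum_divide_distrib)
    finally have p: "(\<Sum>i\<in>UNIV. (cmod (z $ i))\<^sup>2) = (\<Sum>k\<in>UNIV. (cmod (y $ k))\<^sup>2) / ?n"
      by (simp only: of_real_eq_iff)
    have "(\<Sum>k\<in>UNIV. (cmod (y $ k))\<^sup>2) \<le> (\<Sum>k\<in>(UNIV :: 'n set). (lp_norm \<infinity> y)\<^sup>2)"
      by (intro sum_mono power_mono coord_norm_component_le[OF M]) auto
    then have le: "(\<Sum>i\<in>UNIV. (cmod (z $ i))\<^sup>2) \<le> (lp_norm \<infinity> y)\<^sup>2"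
      unfolding p by (simp add: field_simps)
    have "(lp_norm 1 z)\<^sup>2 \<le> (\<Sum>i\<in>UNIV. (cmod (z $ i))\<^sup>2) * ?n"
      unfolding lp_norm_one by (rule sum_squared_le_sum_of_squares)
    also have "\<dots> \<le> (lp_norm \<infinity> y)\<^sup>2 * ?n" using le by (intro mult_right_mono) auto
    finally have "(lp_norm 1 z)\<^sup>2 \<le> ?n * (lp_norm \<infinity> y)\<^sup>2" by (simp only: mult.commute)
    then have "lp_norm 1 z \<le> sqrt (?n * (lp_norm \<infinity> y)\<^sup>2)" by (rule real_le_rsqrt)
    then show ?thesis
      using coord_norm_nonneg[OF M, of y] by (simp add: real_sqrt_mult z_def)
  qed
  ultimately show ?thesis
    using banach_mazur_eqI[OF N M FG, of 1 "sqrt ?n" "sqrt ?n"] op_norm_product_lower_bound[OF n] by simp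
qed

section \<open>Power means and Clarkson's inequality\<close>

lemma powr_convex_nonneg:
  fixes x y :: real
  assumes k: "1 \<le> k" and xy: "0 \<le> x" "0 \<le> y" and uv: "0 \<le> u" "0 \<le> v" "u + v = 1"
  shows "(u * x + v * y) powr k \<le> u * x powr k + v * y powr k"
proof -
  have le: "u powr k \<le> u" if "0 \<le> u" "u \<le> 1" for u :: real
    using that k powr_mono'[of 1 k u] by (cases "u = 0") auto
  consider "x = 0" | "y = 0" | "x > 0" "y > 0" using xy by linarith
  then show ?thesis
  proof cases
    case 1
    then show ?thesis using le[of v] uv xy by (simp add: powr_mult mult_right_mono)
  next
    case 2
    then show ?thesis using le[of u] uv xy by (simp add: powr_mult mult_right_mono)
  next
    case 3
    have u: "u = 1 - v" using uv by simp
    show ?thesis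
      using convex_onD[OF powr_convex[OF k], of v x y] uv 3 unfolding u by simp
  qed
qed

lemma powr_midpoint_convex:
  fixes x y :: real
  assumes "1 \<le> k" "0 \<le> x" "0 \<le> y"
  shows "((x + y) / 2) powr k \<le> (x powr k + y powr k) / 2"
  using powr_convex_nonneg[OF assms, of "1/2" "1/2"] by (simp add: add_divide_distrib)

lemma powr_midpoint_concave:
  fixes x y :: real
  assumes k: "0 < k" "k \<le> 1" and xy: "0 \<le> x" "0 \<le> y"
  shows "(x powr k + y powr k) / 2 \<le> ((x + y) / 2) powr k"
proof -
  have "((x powr k + y powr k) / 2) powr (1 / k) \<le> ((x powr k) powr (1 / k) + (y powr k) powr (1 / k)) / 2"
    using k by (intro powr_midpoint_convex) auto
  also have "\<dots> = (x + y) / 2" using k xy by (simp add: powr_powr)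
  finally have "(((x powr k + y powr k) / 2) powr (1 / k)) powr k \<le> ((x + y) / 2) powr k"
    using k by (intro powr_mono2) auto
  then show ?thesis using k by (simp add: powr_powr)
qed

text \<open>\<open>A + c\<close> and \<open>A - c\<close> are mixtures of \<open>A + C\<close> and
  \<open>A - C\<close> with the weights \<open>u\<close>, \<open>v\<close> interchanged, so adding
  the two convexity inequalities gives total weight 1 on either end.\<close>

lemma powr_spread:
  fixes A c C :: real
  assumes k: "1 \<le> k" and c: "\<bar>c\<bar> \<le> C" "C \<le> A"
  shows "(A + c) powr k + (A - c) powr k \<le> (A + C) powr k + (A - C) powr k"
proof (cases "C = 0")
  case False
  then have C: "C > 0" using c by linarith
  define u where "u = (1 + c / C) / 2"
  define v where "v = (1 - c / C) / 2"
  have uv: "0 \<le> u" "0 \<le> v" "u + v = 1" "v + u = 1"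
    using c C by (auto simp: u_def v_def field_simps abs_le_iff)
  have "A + c = u * (A + C) + v * (A - C)" "A - c = v * (A + C) + u * (A - C)"
    using C by (simp_all add: u_def v_def field_simps)
  then have "(A + c) powr k + (A - c) powr k
      \<le> (u * (A + C) powr k + v * (A - C) powr k) + (v * (A + C) powr k + u * (A - C) powr k)"
    using c C k uv by (auto intro!: add_mono powr_convex_nonneg)
  also have "\<dots> = (u + v) * ((A + C) powr k + (A - C) powr k)" by (simp add: algebra_simps)
  finally show ?thesis using uv by simp
qed (use c in auto)

lemma powr_superadditive:
  fixes x y :: real
  assumes k: "1 \<le> k" and xy: "0 \<le> x" "0 \<le> y"
  shows "x powr k + y powr k \<le> (x + y) powr k"
proof -
  have le: "z powr k \<le> z * w powr (k - 1)" if "0 \<le> z" "z \<le> w" for z w :: real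
  proof (cases "z = 0")
    case False
    then have "z powr k = z * z powr (k - 1)" using that by (simp add: powr_diff)
    also have "\<dots> \<le> z * w powr (k - 1)" using that k by (intro mult_left_mono powr_mono2) auto
    finally show ?thesis .
  qed auto
  have "x powr k + y powr k \<le> x * (x + y) powr (k - 1) + y * (x + y) powr (k - 1)"
    using xy by (intro add_mono le) auto
  also have "\<dots> = (x + y) * (x + y) powr (k - 1)" by (simp add: algebra_simps)
  also have "\<dots> = (x + y) powr k" using xy by (cases "x + y = 0") (simp_all add: powr_diff)
  finally show ?thesis .
qed

text \<open>The exponents \<open>e + 1\<close> and \<open>(e + 1) / e\<close> are conjugate; this is
  the normalized real case of Clarkson's inequality.\<close>

lemma clarkson_unit:
  fixes x e :: real
  assumes e: "1 \<le> e" and x: "0 \<le> x" "x \<le> 1"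
  shows "(1 + x) powr (e + 1) + (1 - x) powr (e + 1) \<le> 2 * (1 + x powr ((e + 1) / e)) powr e"
proof -
  consider "x = 0" | "x = 1" | "0 < x" "x < 1" using x by linarith
  then show ?thesis
  proof cases
    case 2
    then show ?thesis by (simp add: powr_add)
  next
    case 3
    define g where "g y \<alpha> = (1 + \<alpha> powr (- e) * y) * (1 + \<alpha> * y) powr e" for y \<alpha> :: real
    \<comment> \<open>\<open>h\<close> is decreasing on [a, 1]; it takes the left-hand side as value at 1 and the right-hand side at \<open>a\<close>.\<close>
    define h where "h \<alpha> = g x \<alpha> + g (- x) \<alpha>" for \<alpha>
    \<comment> \<open>Chosen so that \<open>a powr (- e) * x = 1\<close>: the first factor of
      \<open>g (- x) a\<close> vanishes and that of \<open>g x a\<close> is 2.\<close>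
    define a where "a = x powr (1 / e)"
    have a: "0 < a" "a \<le> 1" using 3 e by (auto simp: a_def powr_le1)
    have dg: "(g y has_real_derivative e * y * (1 + \<alpha> * y) powr (e - 1) * (1 - \<alpha> powr (- e - 1))) (at \<alpha>)"
      if "\<alpha> > 0" "1 + \<alpha> * y > 0" for y \<alpha>
    proof -
      have 1: "\<alpha> powr (- e) = \<alpha> powr (- e - 1) * \<alpha>" "(1 + \<alpha> * y) powr e = (1 + \<alpha> * y) powr (e - 1) * (1 + \<alpha> * y)"
        using that by (simp_all add: powr_diff)
      have "(g y has_real_derivative
          ((- e) * \<alpha> powr (- e - 1) * y) * (1 + \<alpha> * y) powr e
          + (1 + \<alpha> powr (- e) * y) * (e * (1 + \<alpha> * y) powr (e - 1) * y)) (at \<alpha>)"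
        unfolding g_def using that by (auto intro!: derivative_eq_intros)
      also have "((- e) * \<alpha> powr (- e - 1) * y) * (1 + \<alpha> * y) powr e
          + (1 + \<alpha> powr (- e) * y) * (e * (1 + \<alpha> * y) powr (e - 1) * y)
          = e * y * (1 + \<alpha> * y) powr (e - 1) * (1 - \<alpha> powr (- e - 1))"
        unfolding 1 by (simp add: algebra_simps)
      finally show ?thesis .
    qed
    have "h a \<ge> h 1"
    proof (rule DERIV_nonpos_imp_nonincreasing[OF a(2)])
      fix \<alpha> assume al: "a \<le> \<alpha>" "\<alpha> \<le> 1"
      then have al0: "\<alpha> > 0" using a by linarith
      have ax: "\<alpha> * x < 1" using al al0 3 mult_left_le_one_le[of x \<alpha>] by linarith
      let ?D = "e * x * (1 + \<alpha> * x) powr (e - 1) * (1 - \<alpha> powr (- e - 1))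
        + e * (- x) * (1 + \<alpha> * (- x)) powr (e - 1) * (1 - \<alpha> powr (- e - 1))"
      have "(h has_real_derivative ?D) (at \<alpha>)"
        unfolding h_def using al0 ax 3 by (intro DERIV_add dg) (auto simp: add_pos_pos)
      moreover have "?D = (e * x) * (((1 + \<alpha> * x) powr (e - 1) - (1 - \<alpha> * x) powr (e - 1)) * (1 - \<alpha> powr (- e - 1)))"
        by (simp add: algebra_simps)
      moreover have "(1 - \<alpha> * x) powr (e - 1) \<le> (1 + \<alpha> * x) powr (e - 1)"
        using ax al0 3 e by (intro powr_mono2) auto
      moreover have "1 \<le> \<alpha> powr (- e - 1)"
        using powr_mono'[of "- e - 1" 0 \<alpha>] al al0 e by simp
      ultimately show "\<exists>y. (h has_real_derivative y) (at \<alpha>) \<and> y \<le> 0"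
        using e 3 by (intro exI[of _ ?D] conjI) (auto intro!: mult_nonneg_nonpos)
    qed
    moreover have "h 1 = (1 + x) powr (e + 1) + (1 - x) powr (e + 1)"
      using 3 by (simp add: h_def g_def powr_add)
    moreover have "a powr (- e) * x = 1" using 3 e by (simp add: a_def powr_powr powr_minus)
    then have "h a = 2 * (1 + a * x) powr e" by (simp add: h_def g_def)
    moreover have "a * x = x powr ((e + 1) / e)"
      using 3 e by (simp add: a_def add_divide_distrib powr_add)
    ultimately show ?thesis by simp
  qed simp
qed

text \<open>The relative phase of \<open>a\<close> and \<open>b\<close> enters only through
  \<open>c\<close> in |a + b|^2 = A + c, |a - b|^2 = A - c. By \<open>powr_spread\<close> the worst
  case is the parallel one, with |a| + |b| and |a| - |b|, and homogeneity leads to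
  \<open>clarkson_unit\<close>.\<close>

lemma clarkson_complex:
  fixes a b :: complex and e :: real
  assumes e: "1 \<le> e"
  shows "cmod (a + b) powr (e + 1) + cmod (a - b) powr (e + 1)
    \<le> 2 * (cmod a powr ((e + 1) / e) + cmod b powr ((e + 1) / e)) powr e"
proof -
  have main: "cmod (a + b) powr (e + 1) + cmod (a - b) powr (e + 1)
    \<le> 2 * (cmod a powr ((e + 1) / e) + cmod b powr ((e + 1) / e)) powr e" if le: "cmod b \<le> cmod a" for a b
  proof (cases "a = 0")
    case True
    then show ?thesis using le e by simp
  next
    case False
    define k where "k = (e + 1) / 2"
    have k: "1 \<le> k" "e + 1 = 2 * k" using e by (simp_all add: k_def)
    have sq: "(z\<^sup>2) powr k = \<bar>z\<bar> powr (e + 1)" for z :: real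
      using powr_powr[of "\<bar>z\<bar>" 2 k] by (cases "z = 0") (simp_all add: k(2))
    define A where "A = (cmod a)\<^sup>2 + (cmod b)\<^sup>2"
    define c where "c = 2 * Re (a * cnj b)"
    define C where "C = 2 * (cmod a * cmod b)"
    have p: "(cmod (a + b))\<^sup>2 = A + c" and m: "(cmod (a - b))\<^sup>2 = A - c"
      using cmod_add_sq[of a b] cmod_add_sq[of a "- b"] by (simp_all add: A_def c_def)
    have P: "(cmod a + cmod b)\<^sup>2 = A + C" and Q: "(cmod a - cmod b)\<^sup>2 = A - C"
      by (simp_all add: A_def C_def power2_sum power2_diff)
    have "\<bar>c\<bar> \<le> C" using abs_Re_le_cmod[of "a * cnj b"] by (simp add: c_def C_def norm_mult)
    moreover have "C \<le> A" using Q zero_le_power2[of "cmod a - cmod b"] by linarith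
    ultimately have "(A + c) powr k + (A - c) powr k \<le> (A + C) powr k + (A - C) powr k"
      by (rule powr_spread[OF k(1)])
    then have "cmod (a + b) powr (e + 1) + cmod (a - b) powr (e + 1)
        \<le> (cmod a + cmod b) powr (e + 1) + (cmod a - cmod b) powr (e + 1)"
      unfolding p[symmetric] m[symmetric] P[symmetric] Q[symmetric] sq using le by simp
    also have "\<dots> = cmod a powr (e + 1) * ((1 + cmod b / cmod a) powr (e + 1) + (1 - cmod b / cmod a) powr (e + 1))"
    proof -
      have eq: "cmod a + cmod b = cmod a * (1 + cmod b / cmod a)" "cmod a - cmod b = cmod a * (1 - cmod b / cmod a)"
        using False by (simp_all add: field_simps)
      have "cmod b / cmod a \<le> 1" using le by (simp add: divide_le_eq_1)
      then have "(cmod a * (1 + cmod b / cmod a)) powr (e + 1) = cmod a powr (e + 1) * (1 + cmod b / cmod a) powr (e + 1)"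
        "(cmod a * (1 - cmod b / cmod a)) powr (e + 1) = cmod a powr (e + 1) * (1 - cmod b / cmod a) powr (e + 1)"
        by (intro powr_mult; simp)+
      then show ?thesis unfolding eq by (simp only: distrib_left)
    qed
    also have "\<dots> \<le> cmod a powr (e + 1) * (2 * (1 + (cmod b / cmod a) powr ((e + 1) / e)) powr e)"
      using e le by (intro mult_left_mono clarkson_unit) (auto simp: divide_le_eq_1)
    also have "\<dots> = 2 * (cmod a powr ((e + 1) / e) * (1 + (cmod b / cmod a) powr ((e + 1) / e))) powr e"
      using e by (simp add: powr_mult powr_powr)
    also have "cmod a powr ((e + 1) / e) * (1 + (cmod b / cmod a) powr ((e + 1) / e))
        = cmod a powr ((e + 1) / e) + cmod b powr ((e + 1) / e)"
      using False by (simp add: powr_divide algebra_simps)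
    finally show ?thesis .
  qed
  show ?thesis
  proof (cases "cmod b \<le> cmod a")
    case False
    then show ?thesis using main[where a = b and b = a]
      by (simp add: add.commute norm_minus_commute)
  qed (rule main)
qed

section \<open>Two-dimensional spaces\<close>

text \<open>The parameter is the reciprocal of the exponent, so 0 stands for the maximum norm.\<close>

definition pair_norm :: "real \<Rightarrow> real \<Rightarrow> real \<Rightarrow> real" where
  "pair_norm t a b = (if t = 0 then max a b else (a powr (1 / t) + b powr (1 / t)) powr t)"

lemma lp_norm_2_eq_pair_norm:
  assumes "1 \<le> p"
  shows "lp_norm p (x :: complex ^ 2) = pair_norm (real_of_ereal (1 / p)) (cmod (x $ 1)) (cmod (x $ 2))"
  using assms
proof (cases rule: ereal_ge_one_cases)
  case 1
  have "range (\<lambda>i. cmod (x $ i)) = {cmod (x $ 1), cmod (x $ 2)}" by (simp add: UNIV_2)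
  then show ?thesis by (simp add: 1 lp_norm_infinity pair_norm_def)
next
  case (2 r)
  then have "1 / p = ereal (1 / r)" by (simp add: one_ereal_def)
  then show ?thesis using 2 by (simp add: lp_norm_ereal pair_norm_def sum_2)
qed

lemma pair_norm_mono:
  assumes t: "0 \<le> t" "t \<le> s" and ab: "0 \<le> a" "0 \<le> b"
  shows "pair_norm t a b \<le> pair_norm s a b"
proof (cases "s = 0")
  case True
  then show ?thesis using t by simp
next
  case False
  then have s: "s > 0" using t by simp
  have z: "z = (z powr (1 / s)) powr s" if "0 \<le> z" for z using s that by (simp add: powr_powr)
  show ?thesis
  proof (cases "t = 0")
    case True
    have "a \<le> (a powr (1 / s) + b powr (1 / s)) powr s" "b \<le> (a powr (1 / s) + b powr (1 / s)) powr s"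
      using s by (subst z[OF ab(1)], intro powr_mono2, auto) (subst z[OF ab(2)], intro powr_mono2, auto)
    then show ?thesis using True s by (simp add: pair_norm_def)
  next
    case False
    then have t0: "t > 0" using t by simp
    define U where "U = a powr (1 / s)"
    define V where "V = b powr (1 / s)"
    have UV: "U \<ge> 0" "V \<ge> 0" by (simp_all add: U_def V_def)
    have "a powr (1 / t) = U powr (s / t)" "b powr (1 / t) = V powr (s / t)"
      using s by (simp_all add: U_def V_def powr_powr)
    then have "pair_norm t a b = (U powr (s / t) + V powr (s / t)) powr t" using t0 by (simp add: pair_norm_def)
    also have "\<dots> \<le> ((U + V) powr (s / t)) powr t"
      using t t0 UV by (intro powr_mono2 powr_superadditive) auto
    also have "\<dots> = pair_norm s a b" using t0 s by (simp add: powr_powr pair_norm_def U_def V_def)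
    finally show ?thesis .
  qed
qed

text \<open>The power mean inequality: for t > 0 it is midpoint convexity of the power s / t >= 1 at
  \<open>U\<close> and \<open>V\<close>.\<close>

lemma pair_norm_le:
  assumes t: "0 \<le> t" "t \<le> s" and ab: "0 \<le> a" "0 \<le> b"
  shows "pair_norm s a b \<le> 2 powr (s - t) * pair_norm t a b"
proof (cases "s = 0")
  case True
  then show ?thesis using t by simp
next
  case False
  then have s: "s > 0" using t by simp
  show ?thesis
  proof (cases "t = 0")
    case True
    define m where "m = max a b"
    have m: "a \<le> m" "b \<le> m" "0 \<le> m" using ab by (auto simp: m_def)
    have "a powr (1 / s) + b powr (1 / s) \<le> 2 * m powr (1 / s)"
      using powr_mono2[of "1 / s" a m] powr_mono2[of "1 / s" b m] s m ab by simp
    then have "pair_norm s a b \<le> (2 * m powr (1 / s)) powr s"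
      using s by (simp add: pair_norm_def) (intro powr_mono2, auto)
    also have "\<dots> = 2 powr s * m" using s m by (simp add: powr_mult powr_powr)
    finally show ?thesis using True by (simp add: pair_norm_def m_def)
  next
    case False
    then have t0: "t > 0" using t by simp
    define U where "U = a powr (1 / s)"
    define V where "V = b powr (1 / s)"
    have UV: "U \<ge> 0" "V \<ge> 0" by (simp_all add: U_def V_def)
    have "a powr (1 / t) = U powr (s / t)" "b powr (1 / t) = V powr (s / t)"
      using s by (simp_all add: U_def V_def powr_powr)
    then have pt: "pair_norm t a b = (U powr (s / t) + V powr (s / t)) powr t" using t0 by (simp add: pair_norm_def)
    have "pair_norm s a b = (U + V) powr s" using s by (simp add: pair_norm_def U_def V_def)
    also have "\<dots> = (2 * ((U + V) / 2)) powr s" by (simp only: mult_2 field_sum_of_halves)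
    also have "\<dots> = 2 powr s * ((U + V) / 2) powr s" by (simp only: powr_mult)
    also have "((U + V) / 2) powr s = (((U + V) / 2) powr (s / t)) powr t" using t0 by (simp only: powr_powr) simp
    also have "2 powr s * \<dots> \<le> 2 powr s * ((U powr (s / t) + V powr (s / t)) / 2) powr t"
      using t t0 UV by (intro mult_left_mono powr_mono2 powr_midpoint_convex) auto
    also have "\<dots> = 2 powr (s - t) * pair_norm t a b"
      by (simp add: pt powr_divide powr_diff)
    finally show ?thesis .
  qed
qed

text \<open>The parameters \<open>t\<close> and \<open>1 - t\<close> belong to conjugate exponents.
  At t = 0 this is the triangle inequality; for t > 0 it is Clarkson's inequality with e = (1 - t) /
  t.\<close>

lemma pair_norm_clarkson:
  assumes t: "0 \<le> t" "t \<le> 1/2"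
  shows "pair_norm t (cmod (a + b)) (cmod (a - b)) \<le> 2 powr t * pair_norm (1 - t) (cmod a) (cmod b)"
proof (cases "t = 0")
  case True
  then show ?thesis using norm_triangle_ineq[of a b] norm_triangle_ineq4[of a b] by (simp add: pair_norm_def)
next
  case False
  then have t0: "t > 0" using t by simp
  define e where "e = (1 - t) / t"
  have e: "1 \<le> e" "e + 1 = 1 / t" "(e + 1) / e = 1 / (1 - t)" "e * t = 1 - t"
    using t t0 by (simp_all add: e_def field_simps)
  have "pair_norm t (cmod (a + b)) (cmod (a - b)) = (cmod (a + b) powr (e + 1) + cmod (a - b) powr (e + 1)) powr t"
    using t0 by (simp add: pair_norm_def e(2))
  also have "\<dots> \<le> (2 * (cmod a powr ((e + 1) / e) + cmod b powr ((e + 1) / e)) powr e) powr t"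
    using t0 by (intro powr_mono2 clarkson_complex e) auto
  also have "\<dots> = 2 powr t * pair_norm (1 - t) (cmod a) (cmod b)"
    using t by (simp add: powr_mult powr_powr e(3,4) pair_norm_def)
  finally show ?thesis .
qed

text \<open>The estimate factors through the Euclidean norm, where the Hadamard matrix multiplies
  norms by sqrt 2.\<close>

lemma pair_norm_hadamard:
  assumes t: "0 \<le> t" "t \<le> 1/2" and s: "1/2 \<le> s"
  shows "pair_norm s (cmod (a + b)) (cmod (a - b)) \<le> 2 powr (1/2 + s - t) * pair_norm t (cmod a) (cmod b)"
proof -
  have "pair_norm s (cmod (a + b)) (cmod (a - b)) \<le> 2 powr (s - 1/2) * pair_norm (1/2) (cmod (a + b)) (cmod (a - b))"
    using s by (intro pair_norm_le) auto
  also have "\<dots> \<le> 2 powr (s - 1/2) * (2 powr (1/2) * pair_norm (1/2) (cmod a) (cmod b))"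
    using pair_norm_clarkson[of "1/2" a b] by (intro mult_left_mono) auto
  also have "\<dots> \<le> 2 powr (s - 1/2) * (2 powr (1/2) * (2 powr (1/2 - t) * pair_norm t (cmod a) (cmod b)))"
    using t by (intro mult_left_mono pair_norm_le) auto
  also have "\<dots> = 2 powr ((s - 1/2) + (1/2) + (1/2 - t)) * pair_norm t (cmod a) (cmod b)"
    by (simp only: powr_add mult.assoc)
  also have "(s - 1/2) + (1/2) + (1/2 - t) = 1/2 + s - t" by simp
  finally show ?thesis .
qed

lemma pair_norm_nonneg: "0 \<le> a \<Longrightarrow> 0 \<le> pair_norm t a b"
  by (auto simp: pair_norm_def)

text \<open>\<open>t\<close> and \<open>s\<close> need not be conjugate, so the estimate passes
  through the conjugate pair r, 1 - r with t <= r <= 1/2 <= 1 - r <= s. Taking \<open>r\<close> as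
  small as possible gives the maximum in the exponent.\<close>

lemma pair_norm_hadamard_inverse:
  assumes t: "0 \<le> t" "t \<le> 1/2" and s: "1/2 \<le> s" "s \<le> 1"
  shows "pair_norm t (cmod (a + b)) (cmod (a - b)) \<le> 2 powr (max t (1 - s)) * pair_norm s (cmod a) (cmod b)"
proof -
  define r where "r = max t (1 - s)"
  have r: "0 \<le> r" "r \<le> 1/2" "t \<le> r" "1 - r \<le> s" "0 \<le> 1 - r" using t s by (auto simp: r_def max_def)
  have "pair_norm t (cmod (a + b)) (cmod (a - b)) \<le> pair_norm r (cmod (a + b)) (cmod (a - b))"
    using t r by (intro pair_norm_mono) auto
  also have "\<dots> \<le> 2 powr r * pair_norm (1 - r) (cmod a) (cmod b)" using r by (intro pair_norm_clarkson)
  also have "\<dots> \<le> 2 powr r * pair_norm s (cmod a) (cmod b)" using r by (intro mult_left_mono pair_norm_mono) auto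
  finally show ?thesis by (simp add: r_def)
qed

text \<open>For p = 1/t >= 2, midpoint convexity of the power p/2 gives (x^2 + y^2)^(p/2) <= 2^(p/2)
  (x^p + y^p) / 2 in each coordinate. Summing over the coordinates and taking the p-th root leaves
  the factor sqrt 2.\<close>

lemma pair_norm_type:
  fixes f1 f2 g1 g2 h1 h2 \<tau> :: real
  assumes t: "0 \<le> t" "t \<le> 1/2"
    and f: "0 \<le> f1" "0 \<le> f2" "pair_norm t f1 f2 \<le> \<tau>" and g: "0 \<le> g1" "0 \<le> g2" "pair_norm t g1 g2 \<le> \<tau>"
    and h: "0 \<le> h1" "h1\<^sup>2 \<le> f1\<^sup>2 + g1\<^sup>2" "0 \<le> h2" "h2\<^sup>2 \<le> f2\<^sup>2 + g2\<^sup>2"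
  shows "pair_norm t h1 h2 \<le> sqrt 2 * \<tau>"
proof (cases "t = 0")
  case True
  have \<tau>: "0 \<le> \<tau>" using f True by (simp add: pair_norm_def)
  have "h \<le> sqrt 2 * \<tau>" if "h\<^sup>2 \<le> x\<^sup>2 + y\<^sup>2" "0 \<le> x" "x \<le> \<tau>" "0 \<le> y" "y \<le> \<tau>" for h x y
  proof (rule power2_le_imp_le)
    have "h\<^sup>2 \<le> \<tau>\<^sup>2 + \<tau>\<^sup>2" using that power_mono[of x \<tau> 2] power_mono[of y \<tau> 2] by linarith
    then show "h\<^sup>2 \<le> (sqrt 2 * \<tau>)\<^sup>2" by (simp add: power_mult_distrib)
  qed (use \<tau> in simp)
  then show ?thesis using True f g h by (simp add: pair_norm_def)
next
  case False
  then have t0: "t > 0" using t by simp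
  define k where "k = 1 / (2 * t)"
  have k: "1 \<le> k" "1 / t = 2 * k" "k * t = 1/2" using t t0 by (simp_all add: k_def field_simps)
  have \<tau>: "0 \<le> \<tau>" using f pair_norm_nonneg order_trans by blast
  have sq: "(z\<^sup>2) powr k = z powr (1 / t)" if "0 \<le> z" for z :: real
    using powr_powr[of z 2 k] that by (cases "z = 0") (simp_all add: k(2))
  have bd: "x powr (1 / t) + y powr (1 / t) \<le> \<tau> powr (1 / t)" if "0 \<le> x" "0 \<le> y" "pair_norm t x y \<le> \<tau>" for x y
  proof -
    have "x powr (1 / t) + y powr (1 / t) = (pair_norm t x y) powr (1 / t)"
      using t0 by (simp add: pair_norm_def powr_powr)
    also have "\<dots> \<le> \<tau> powr (1 / t)" using that t0 by (intro powr_mono2 pair_norm_nonneg) auto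
    finally show ?thesis .
  qed
  have one: "z powr (1 / t) \<le> 2 powr k * ((x powr (1 / t) + y powr (1 / t)) / 2)"
    if "0 \<le> x" "0 \<le> y" "0 \<le> z" "z\<^sup>2 \<le> x\<^sup>2 + y\<^sup>2" for x y z
  proof -
    have "z powr (1 / t) \<le> (2 * ((x\<^sup>2 + y\<^sup>2) / 2)) powr k"
      unfolding sq[OF that(3), symmetric] using that k by (intro powr_mono2) auto
    also have "\<dots> = 2 powr k * ((x\<^sup>2 + y\<^sup>2) / 2) powr k" by (simp only: powr_mult)
    also have "\<dots> \<le> 2 powr k * (((x\<^sup>2) powr k + (y\<^sup>2) powr k) / 2)"
      using k by (intro mult_left_mono powr_midpoint_convex) auto
    finally show ?thesis unfolding sq[OF that(1)] sq[OF that(2)] .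
  qed
  have "h1 powr (1 / t) + h2 powr (1 / t)
      \<le> 2 powr k * ((f1 powr (1 / t) + g1 powr (1 / t)) / 2) + 2 powr k * ((f2 powr (1 / t) + g2 powr (1 / t)) / 2)"
    using one[of f1 g1 h1] one[of f2 g2 h2] f g h by (intro add_mono) auto
  also have "\<dots> = 2 powr k * (((f1 powr (1 / t) + f2 powr (1 / t)) + (g1 powr (1 / t) + g2 powr (1 / t))) / 2)"
    by (simp add: field_simps)
  also have "\<dots> \<le> 2 powr k * ((\<tau> powr (1 / t) + \<tau> powr (1 / t)) / 2)"
    using bd[of f1 f2] bd[of g1 g2] f g by (intro mult_left_mono divide_right_mono add_mono) auto
  finally have "h1 powr (1 / t) + h2 powr (1 / t) \<le> 2 powr k * \<tau> powr (1 / t)" by simp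
  then have "pair_norm t h1 h2 \<le> (2 powr k * \<tau> powr (1 / t)) powr t"
    using t0 by (simp add: pair_norm_def) (intro powr_mono2, auto)
  also have "\<dots> = 2 powr (k * t) * \<tau>" using t0 \<tau> by (simp add: powr_mult powr_powr)
  also have "\<dots> = sqrt 2 * \<tau>" unfolding k(3) by (simp add: powr_half_sqrt)
  finally show ?thesis .
qed

text \<open>The mirror image of \<open>pair_norm_type\<close>: for exponents 1/s <= 2 the power
  \<open>k\<close> is at most 1, and concavity reverses every estimate.\<close>

lemma pair_norm_cotype:
  fixes f1 f2 g1 g2 h1 h2 \<mu> :: real
  assumes s: "1/2 \<le> s" and \<mu>: "0 \<le> \<mu>"
    and f: "0 \<le> f1" "0 \<le> f2" "\<mu> \<le> pair_norm s f1 f2" and g: "0 \<le> g1" "0 \<le> g2" "\<mu> \<le> pair_norm s g1 g2"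
    and h: "0 \<le> h1" "f1\<^sup>2 + g1\<^sup>2 \<le> h1\<^sup>2" "0 \<le> h2" "f2\<^sup>2 + g2\<^sup>2 \<le> h2\<^sup>2"
  shows "sqrt 2 * \<mu> \<le> pair_norm s h1 h2"
proof -
  have s0: "s > 0" using s by simp
  define k where "k = 1 / (2 * s)"
  have k: "0 < k" "k \<le> 1" "1 / s = 2 * k" "k * s = 1/2" using s s0 by (simp_all add: k_def field_simps)
  have sq: "(z\<^sup>2) powr k = z powr (1 / s)" if "0 \<le> z" for z :: real
    using powr_powr[of z 2 k] that by (cases "z = 0") (simp_all add: k(3))
  have bd: "\<mu> powr (1 / s) \<le> x powr (1 / s) + y powr (1 / s)" if "\<mu> \<le> pair_norm s x y" for x y
  proof -
    have "\<mu> powr (1 / s) \<le> (pair_norm s x y) powr (1 / s)" using that s0 \<mu> by (intro powr_mono2) auto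
    also have "\<dots> = x powr (1 / s) + y powr (1 / s)"
      using s0 by (simp add: pair_norm_def powr_powr)
    finally show ?thesis .
  qed
  have one: "2 powr k * ((x powr (1 / s) + y powr (1 / s)) / 2) \<le> z powr (1 / s)"
    if "0 \<le> x" "0 \<le> y" "0 \<le> z" "x\<^sup>2 + y\<^sup>2 \<le> z\<^sup>2" for x y z
  proof -
    have "2 powr k * ((x powr (1 / s) + y powr (1 / s)) / 2) \<le> 2 powr k * ((x\<^sup>2 + y\<^sup>2) / 2) powr k"
      unfolding sq[OF that(1), symmetric] sq[OF that(2), symmetric]
      using k by (intro mult_left_mono powr_midpoint_concave) auto
    also have "\<dots> = (2 * ((x\<^sup>2 + y\<^sup>2) / 2)) powr k" by (simp only: powr_mult)
    also have "\<dots> \<le> z powr (1 / s)"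
      unfolding sq[OF that(3), symmetric] using that k by (intro powr_mono2) auto
    finally show ?thesis .
  qed
  have "2 powr k * \<mu> powr (1 / s) = 2 powr k * ((\<mu> powr (1 / s) + \<mu> powr (1 / s)) / 2)" by simp
  also have "\<dots> \<le> 2 powr k * (((f1 powr (1 / s) + f2 powr (1 / s)) + (g1 powr (1 / s) + g2 powr (1 / s))) / 2)"
    using bd[OF f(3)] bd[OF g(3)] by (intro mult_left_mono divide_right_mono add_mono) auto
  also have "\<dots> = 2 powr k * ((f1 powr (1 / s) + g1 powr (1 / s)) / 2) + 2 powr k * ((f2 powr (1 / s) + g2 powr (1 / s)) / 2)"
    by (simp add: field_simps)
  also have "\<dots> \<le> h1 powr (1 / s) + h2 powr (1 / s)"
    using one[of f1 g1 h1] one[of f2 g2 h2] f g h by (intro add_mono) auto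
  finally have "(2 powr k * \<mu> powr (1 / s)) powr s \<le> pair_norm s h1 h2"
    using s0 by (simp add: pair_norm_def) (intro powr_mono2, auto)
  moreover have "(2 powr k * \<mu> powr (1 / s)) powr s = sqrt 2 * \<mu>"
  proof -
    have "(2 powr k * \<mu> powr (1 / s)) powr s = 2 powr (k * s) * \<mu>" using s0 \<mu> by (simp add: powr_mult powr_powr)
    then show ?thesis unfolding k(4) by (simp add: powr_half_sqrt)
  qed
  ultimately show ?thesis by simp
qed

lemma unimodular_two_rows_ge:
  fixes a b c d :: complex
  obtains t where "cmod t = 1"
    "(cmod a)\<^sup>2 + (cmod b)\<^sup>2 \<le> (cmod (a + b * t))\<^sup>2" "(cmod c)\<^sup>2 + (cmod d)\<^sup>2 \<le> (cmod (c + d * t))\<^sup>2"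
proof -
  obtain t where t: "cmod t = 1" "Re (t * (cnj a * b)) \<le> 0" "Re (t * (cnj c * d)) \<le> 0"
    by (rule unimodular_halfplane)
  have "Re (x * cnj (y * - t)) = - Re (t * (cnj x * y))" for x y
    by (simp add: algebra_simps)
  then have "(cmod (x + y * - t))\<^sup>2 = (cmod x)\<^sup>2 + (cmod y)\<^sup>2 - 2 * Re (t * (cnj x * y))" for x y
    by (simp only: cmod_add_sq norm_mult norm_minus_cancel t(1)) simp
  then show ?thesis using that[of "- t"] t by simp
qed

section \<open>Part (iii), in terms of the reciprocal exponents t <= 1/2 <= s\<close>

context
  fixes p q :: ereal and t s :: real
  assumes q: "1 \<le> q" "q \<le> 2" and p: "2 \<le> p"
  defines "t \<equiv> real_of_ereal (1 / p)" and "s \<equiv> real_of_ereal (1 / q)"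
begin

lemma exponent_bounds: "0 \<le> t" "t \<le> 1/2" "1/2 \<le> s" "s \<le> 1"
proof -
  have "p = \<infinity> \<or> (\<exists>r. p = ereal r \<and> 2 \<le> r)" using p by (cases p) auto
  then show "0 \<le> t" "t \<le> 1/2" by (auto simp: t_def one_ereal_def field_simps)
  obtain r where "q = ereal r" "1 \<le> r" "r \<le> 2" using q by (cases q) auto
  then show "1/2 \<le> s" "s \<le> 1" by (auto simp: s_def one_ereal_def field_simps)
qed

lemma lp_norm_pair:
  "lp_norm p (x :: complex ^ 2) = pair_norm t (cmod (x $ 1)) (cmod (x $ 2))"
  "lp_norm q (x :: complex ^ 2) = pair_norm s (cmod (x $ 1)) (cmod (x $ 2))"
proof -
  have "1 \<le> p" using p by (rule order_trans[rotated]) simp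
  then show "lp_norm p x = pair_norm t (cmod (x $ 1)) (cmod (x $ 2))"
    unfolding t_def by (rule lp_norm_2_eq_pair_norm)
  show "lp_norm q x = pair_norm s (cmod (x $ 1)) (cmod (x $ 2))"
    unfolding s_def by (rule lp_norm_2_eq_pair_norm[OF q(1)])
qed

lemma coord_norm_pq: "coord_norm (lp_norm p :: complex ^ 2 \<Rightarrow> real)" "coord_norm (lp_norm q :: complex ^ 2 \<Rightarrow> real)"
proof -
  have "1 \<le> p" using p by (rule order_trans[rotated]) simp
  then show "coord_norm (lp_norm p :: complex ^ 2 \<Rightarrow> real)" by (rule coord_norm_lp_norm)
  show "coord_norm (lp_norm q :: complex ^ 2 \<Rightarrow> real)" using q by (intro coord_norm_lp_norm)
qed

lemma lp_norm_axis:
  "lp_norm p (axis i 1 :: complex ^ 2) = 1" "lp_norm q (axis i 1 :: complex ^ 2) = 1"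
  using exponent_bounds exhaust_2[of i] by (auto simp: lp_norm_pair pair_norm_def axis_def)

lemma lp_norm_unimodular:
  assumes "cmod \<theta> = 1"
  shows "lp_norm p (axis 1 1 + \<theta> *s axis 2 1 :: complex ^ 2) = 2 powr t"
    "lp_norm q (axis 1 1 + \<theta> *s axis 2 1 :: complex ^ 2) = 2 powr s"
  using exponent_bounds assms by (auto simp: lp_norm_pair pair_norm_def axis_def)

text \<open>The preimages of the two unit vectors have p-norm at most \<open>\<tau>\<close>, so type
  2 gives a combination \<open>h\<close> of p-norm at most sqrt 2 times \<open>\<tau>\<close>. Its
  image has two unimodular coordinates, hence q-norm \<open>2 powr s\<close>.\<close>

lemma op_norm_product_ge_right:
  fixes A :: "complex ^ 2 \<Rightarrow> complex ^ 2"
  assumes A: "Vector_Spaces.linear (*s) (*s) A" "bij A"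
  shows "2 powr (s - 1/2) \<le> op_norm (lp_norm p) (lp_norm q) A * op_norm (lp_norm q) (lp_norm p) (inv A)"
proof -
  note N = coord_norm_pq(1) and M = coord_norm_pq(2)
  define \<sigma> where "\<sigma> = op_norm (lp_norm p) (lp_norm q) A"
  define \<tau> where "\<tau> = op_norm (lp_norm q) (lp_norm p) (inv A)"
  have \<sigma>: "0 \<le> \<sigma>" unfolding \<sigma>_def by (rule op_norm_nonneg[OF N M A(1)])
  define f where "f = inv A (axis 1 1)"
  define g where "g = inv A (axis 2 1)"
  have le: "lp_norm p (inv A (axis i 1)) \<le> \<tau>" for i
    using op_norm_bound[OF M N linear_inv[OF A], of "axis i 1"] by (simp add: lp_norm_axis \<tau>_def)
  obtain \<theta> where \<theta>: "cmod \<theta> = 1"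
    "(cmod (f $ 1 + g $ 1 * \<theta>))\<^sup>2 \<le> (cmod (f $ 1))\<^sup>2 + (cmod (g $ 1))\<^sup>2"
    "(cmod (f $ 2 + g $ 2 * \<theta>))\<^sup>2 \<le> (cmod (f $ 2))\<^sup>2 + (cmod (g $ 2))\<^sup>2"
    by (rule unimodular_two_rows)
  define h where "h = f + \<theta> *s g"
  have "lp_norm p h \<le> sqrt 2 * \<tau>"
    unfolding lp_norm_pair
    by (rule pair_norm_type[where ?f1.0 = "cmod (f $ 1)" and ?f2.0 = "cmod (f $ 2)"
          and ?g1.0 = "cmod (g $ 1)" and ?g2.0 = "cmod (g $ 2)"])
       (use exponent_bounds \<theta> le[of 1] le[of 2] in
         \<open>simp_all add: h_def f_def[symmetric] g_def[symmetric] lp_norm_pair mult.commute\<close>)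
  have Ah: "A h = axis 1 1 + \<theta> *s axis 2 1"
  proof -
    interpret Vector_Spaces.linear "(*s)" "(*s)" A by (rule A)
    show ?thesis by (simp add: h_def add scale f_def g_def inv_bij(2)[OF A(2)])
  qed
  have "2 powr s = lp_norm q (A h)" by (simp add: Ah lp_norm_unimodular \<theta>)
  also have "\<dots> \<le> \<sigma> * lp_norm p h" unfolding \<sigma>_def by (rule op_norm_bound[OF N M A(1)])
  also have "\<dots> \<le> \<sigma> * (sqrt 2 * \<tau>)" using \<open>lp_norm p h \<le> _\<close> \<sigma> by (rule mult_left_mono)
  finally have "2 powr s / 2 powr (1/2) \<le> \<sigma> * \<tau>" by (simp add: powr_half_sqrt divide_le_eq mult_ac)
  then show ?thesis by (simp add: \<sigma>_def \<tau>_def powr_diff)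
qed

text \<open>Here the images of the unit vectors are combined: each has q-norm at least
  \<open>1 / \<tau>\<close>, so cotype 2 gives a combination of q-norm at least
  \<open>sqrt 2 / \<tau>\<close>, whereas its preimage has p-norm only
  \<open>2 powr t\<close>.\<close>

lemma op_norm_product_ge_left:
  fixes A :: "complex ^ 2 \<Rightarrow> complex ^ 2"
  assumes A: "Vector_Spaces.linear (*s) (*s) A" "bij A"
  shows "2 powr (1/2 - t) \<le> op_norm (lp_norm p) (lp_norm q) A * op_norm (lp_norm q) (lp_norm p) (inv A)"
proof -
  note N = coord_norm_pq(1) and M = coord_norm_pq(2)
  define \<sigma> where "\<sigma> = op_norm (lp_norm p) (lp_norm q) A"
  define \<tau> where "\<tau> = op_norm (lp_norm q) (lp_norm p) (inv A)"
  have \<tau>: "0 < \<tau>" unfolding \<tau>_def by (rule op_norm_pos[OF M N linear_inv[OF A]]) (rule bij_imp_bij_inv[OF A(2)])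
  define f where "f = A (axis 1 1)"
  define g where "g = A (axis 2 1)"
  have ge: "1 / \<tau> \<le> lp_norm q (A (axis i 1))" for i
    using op_norm_bound[OF M N linear_inv[OF A], of "A (axis i 1)"] \<tau>
    by (simp add: inv_bij(1)[OF A(2)] lp_norm_axis \<tau>_def[symmetric] divide_le_eq mult.commute)
  obtain \<theta> where \<theta>: "cmod \<theta> = 1"
    "(cmod (f $ 1))\<^sup>2 + (cmod (g $ 1))\<^sup>2 \<le> (cmod (f $ 1 + g $ 1 * \<theta>))\<^sup>2"
    "(cmod (f $ 2))\<^sup>2 + (cmod (g $ 2))\<^sup>2 \<le> (cmod (f $ 2 + g $ 2 * \<theta>))\<^sup>2"
    by (rule unimodular_two_rows_ge)
  define h where "h = f + \<theta> *s g"
  have Ah: "A (axis 1 1 + \<theta> *s axis 2 1) = h"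
  proof -
    interpret Vector_Spaces.linear "(*s)" "(*s)" A by (rule A)
    show ?thesis by (simp add: h_def add scale f_def g_def)
  qed
  have "sqrt 2 * (1 / \<tau>) \<le> lp_norm q h"
    unfolding lp_norm_pair
    by (rule pair_norm_cotype[where ?f1.0 = "cmod (f $ 1)" and ?f2.0 = "cmod (f $ 2)"
          and ?g1.0 = "cmod (g $ 1)" and ?g2.0 = "cmod (g $ 2)"])
       (use exponent_bounds \<theta> ge[of 1] ge[of 2] \<tau> in
         \<open>simp_all add: h_def f_def[symmetric] g_def[symmetric] lp_norm_pair mult.commute\<close>)
  also have "\<dots> \<le> \<sigma> * 2 powr t"
    using op_norm_bound[OF N M A(1), of "axis 1 1 + \<theta> *s axis 2 1"]
    by (simp add: Ah lp_norm_unimodular \<theta> \<sigma>_def)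
  finally have "2 powr (1/2) / 2 powr t \<le> \<sigma> * \<tau>"
    using \<tau> by (simp add: powr_half_sqrt field_simps)
  then show ?thesis by (simp add: \<sigma>_def \<tau>_def powr_diff)
qed

lemma banach_mazur_lp_lq_2:
  "banach_mazur (lp_norm p :: complex ^ 2 \<Rightarrow> real) (lp_norm q :: complex ^ 2 \<Rightarrow> real)
    = 2 powr max (1 / 2 - t) (s - 1 / 2)"
proof -
  define H :: "complex ^ 2 ^ 2" where "H = (\<chi> i j. if i = 2 \<and> j = 2 then -1 else 1)"
  define K :: "complex ^ 2 ^ 2" where "K = (\<chi> i j. (if i = 2 \<and> j = 2 then -1 else 1) / 2)"
  have HK: "H ** K = mat 1" "K ** H = mat 1"
    by (simp_all add: vec_eq_iff forall_2 matrix_matrix_mult_def sum_2 mat_def H_def K_def)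
  have Hx: "(H *v x) $ 1 = x $ 1 + x $ 2" "(H *v x) $ 2 = x $ 1 - x $ 2" for x
    by (simp_all add: matrix_vector_mult_def sum_2 H_def)
  have Kx: "K *v x = (1/2) *s (H *v x)" for x
    by (simp add: vec_eq_iff matrix_vector_mult_def sum_2 H_def K_def forall_2 algebra_simps)
  have "lp_norm q (H *v x) \<le> 2 powr (1/2 + s - t) * lp_norm p x" for x
    unfolding lp_norm_pair Hx using exponent_bounds by (intro pair_norm_hadamard) auto
  moreover have "lp_norm p (K *v x) \<le> 2 powr (max t (1 - s) - 1) * lp_norm q x" for x
  proof -
    have "lp_norm p (H *v x) \<le> 2 powr (max t (1 - s)) * lp_norm q x"
      unfolding lp_norm_pair Hx using exponent_bounds by (intro pair_norm_hadamard_inverse) auto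
    then show ?thesis
      by (simp add: Kx coord_norm_scale[OF coord_norm_pq(1)] powr_diff norm_divide)
  qed
  \<comment> \<open>The exponents add up to s - t - 1/2 + max t (1 - s), which is the maximum of s -
    1/2 and 1/2 - t.\<close>
  moreover have "2 powr (1/2 + s - t) * 2 powr (max t (1 - s) - 1) \<le> 2 powr max (1 / 2 - t) (s - 1 / 2)"
    by (simp add: max_def flip: powr_add)
  moreover have "2 powr max (1 / 2 - t) (s - 1 / 2)
      \<le> op_norm (lp_norm p) (lp_norm q) A * op_norm (lp_norm q) (lp_norm p) (inv A)"
    if "Vector_Spaces.linear (*s) (*s) A" "bij A" for A :: "complex ^ 2 \<Rightarrow> complex ^ 2"
    using op_norm_product_ge_left[OF that] op_norm_product_ge_right[OF that] by (simp add: max_def)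
  ultimately show ?thesis
    by (intro banach_mazur_eqI[OF coord_norm_pq HK, of "2 powr (1/2 + s - t)" "2 powr (max t (1 - s) - 1)"]) auto
qed

end

theorem theorem1p5:
  shows
    "(CARD('n::finite) \<in> {2, 3} \<longrightarrow>
        (\<forall>a :: 'n \<Rightarrow> complex ^ 'n. (\<forall>i. lp_norm \<infinity> (a i) \<le> 1) \<longrightarrow>
           (\<exists>x. unimodular x \<and> (\<forall>i. cmod (cinner x (a i)) \<le> sqrt (real CARD('n))))))
     \<and> (CARD('n) \<in> {2, 3} \<longrightarrow>
        banach_mazur (lp_norm 1 :: complex ^ 'n \<Rightarrow> real) (lp_norm \<infinity> :: complex ^ 'n \<Rightarrow> real)
          = sqrt (real CARD('n)))
     \<and> (\<forall>p q :: ereal. 1 \<le> q \<and> q \<le> 2 \<and> 2 \<le> p \<and> p \<le> \<infinity> \<longrightarrow>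
        banach_mazur (lp_norm p :: complex ^ 2 \<Rightarrow> real) (lp_norm q :: complex ^ 2 \<Rightarrow> real)
          = 2 powr max (1 / 2 - real_of_ereal (1 / p)) (real_of_ereal (1 / q) - 1 / 2))"
proof (intro conjI impI allI)
  fix a :: "'n \<Rightarrow> complex ^ 'n"
  assume n: "CARD('n) \<in> {2, 3}" and a: "\<forall>i. lp_norm \<infinity> (a i) \<le> 1"
  have "cmod (a i $ j) \<le> 1" for i j
    using coord_norm_component_le[OF coord_norm_lp_norm, of \<infinity> "a i" j] a by (auto intro: order_trans)
  then show "\<exists>x. unimodular x \<and> (\<forall>i. cmod (cinner x (a i)) \<le> sqrt (real CARD('n)))"
    by (rule unimodular_small_products[OF n])
next
  assume "CARD('n) \<in> {2, 3}"
  then show "banach_mazur (lp_norm 1 :: complex ^ 'n \<Rightarrow> real) (lp_norm \<infinity> :: complex ^ 'n \<Rightarrow> real) = sqrt (real CARD('n))"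
    by (rule banach_mazur_l1_linf)
next
  fix p q :: ereal
  assume "1 \<le> q \<and> q \<le> 2 \<and> 2 \<le> p \<and> p \<le> \<infinity>"
  then show "banach_mazur (lp_norm p :: complex ^ 2 \<Rightarrow> real) (lp_norm q :: complex ^ 2 \<Rightarrow> real)
      = 2 powr max (1 / 2 - real_of_ereal (1 / p)) (real_of_ereal (1 / q) - 1 / 2)"
    by (intro banach_mazur_lp_lq_2) auto
qed

end
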